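(* Let $1<p<\infty$, $\frac1p+\frac1q=1$, and let $w=(w_n)_{n\in\mathbb{Z}}$ be a complex sequence with $$\sup_{n\in\mathbb{Z}}\left|\frac{w_{n+1}a_{n+1}}{a_n}\right|<\infty\qquad\text{and}\qquad \limsup_{n\to+\infty}\left|\frac{b_n}{a_{n+1}}\right|<1.$$ Consider the statements for $B_w$ on $\ell^p_{a,b}(\Omega_{r,R})$: (i) $B_w$ is chaotic; (ii) $B_w$ has a non-trivial periodic vector; (iii) $\displaystyle\sum_{n=1}^{\infty}\left|\frac{w_0\cdots w_{-n+1}}{a_{-n}}\right|^p<\infty$ and $\displaystyle\sum_{n=1}^{\infty}\left|\frac{1}{w_1\cdots w_na_n}\right|^p<\infty$. Then (i) $\Rightarrow$ (ii) $\Rightarrow$ (iii). If in addition $$\sum_{n\ge1}\Big(\sum_{j\ge1}\Big|\prod_{k=1}^{j}\frac{b_{n+k-1}}{a_{n+k}}\Big|^p\Big)^{q/p}<\infty,$$ then (i), (ii), (iii) are equivalent.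
   Context: Let $a=(a_n)_{n\in\mathbb{Z}}$ be complex with $a_n\ne0$ for all $n$, and let $b=(b_n)_{n\ge0}$ be complex, with $b_n:=0$ for $n\le-1$. Put $f_n(z)=(a_n+b_nz)z^n$ for $n\ge0$ and $f_n(z)=a_nz^n$ for $n\le-1$. Let $r=\limsup_{n\to+\infty}|a_{-n}|^{1/n}$ and $1/R=\limsup_{n\to+\infty}(|a_n|+|b_n|)^{1/n}$, this last limsup being finite, and assume $r<R$; $\Omega_{r,R}=\{z:r<|z|<R\}$. $\ell^p_{a,b}(\Omega_{r,R})$ is the Banach space of analytic functions on $\Omega_{r,R}$ of the form $f=\sum_{n\in\mathbb{Z}}\lambda_nf_n$ with $(\lambda_n)\in\ell^p(\mathbb{Z})$ (locally uniformly convergent, coefficients unique), normed by $\|f\|=(\sum_n|\lambda_n|^p)^{1/p}$. $B_w$ acts by $B_w(\sum_n\widehat f(n)z^n)=\sum_nw_n\widehat f(n)z^{n-1}$ on Laurent expansions. An operator is chaotic if it is hypercyclic (some orbit dense) and has a dense set of periodic vectors; a vector $v$ is periodic if $T^kv=v$ for some $k\ge1$; non-trivial means $v\ne0$.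
   Formalization: All weights w_n are assumed nonzero: if w_n=0 for some n≥1 the second series in (iii) is undefined, and if w_0=0 then (iii) can hold (e.g. with b=0) although B_w is not hypercyclic, so the stated equivalence fails. *)

theory Defs
  imports "HOL-Analysis.Analysis" "HOL-Library.Liminf_Limsup" "HOL-Library.Function_Algebras"
begin

definition r_ann :: "(int \<Rightarrow> complex) \<Rightarrow> ereal" where
  "r_ann a = limsup (\<lambda>n::nat. ereal (norm (a (- int n)) powr (1 / real n)))"

definition invR_ann :: "(int \<Rightarrow> complex) \<Rightarrow> (int \<Rightarrow> complex) \<Rightarrow> ereal" where
  "invR_ann a b = limsup (\<lambda>n::nat. ereal ((norm (a (int n)) + norm (b (int n))) powr (1 / real n)))"

definition R_ann :: "(int \<Rightarrow> complex) \<Rightarrow> (int \<Rightarrow> complex) \<Rightarrow> ereal" where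
  "R_ann a b = inverse (invR_ann a b)"

definition Omega :: "(int \<Rightarrow> complex) \<Rightarrow> (int \<Rightarrow> complex) \<Rightarrow> complex set" where
  "Omega a b = {z. r_ann a < ereal (cmod z) \<and> ereal (cmod z) < R_ann a b}"

text \<open>The basis functions f_n (b is assumed to vanish at negative indices).\<close>
definition fb :: "(int \<Rightarrow> complex) \<Rightarrow> (int \<Rightarrow> complex) \<Rightarrow> int \<Rightarrow> complex \<Rightarrow> complex" where
  "fb a b n z = (if 0 \<le> n then (a n + b n * z) * z powi n else a n * z powi n)"

definition lp :: "real \<Rightarrow> (int \<Rightarrow> complex) \<Rightarrow> bool" where
  "lp p c = ((\<lambda>n. norm (c n) powr p) summable_on UNIV)"

definition lp_norm :: "real \<Rightarrow> (int \<Rightarrow> complex) \<Rightarrow> real" where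
  "lp_norm p c = (\<Sum>\<^sub>\<infinity>n. norm (c n) powr p) powr (1 / p)"

definition Phi :: "(int \<Rightarrow> complex) \<Rightarrow> (int \<Rightarrow> complex) \<Rightarrow> (int \<Rightarrow> complex) \<Rightarrow> complex \<Rightarrow> complex" where
  "Phi a b c = (\<lambda>z. if z \<in> Omega a b then (\<Sum>\<^sub>\<infinity>n. c n * fb a b n z) else 0)"

definition Xsp :: "real \<Rightarrow> (int \<Rightarrow> complex) \<Rightarrow> (int \<Rightarrow> complex) \<Rightarrow> (complex \<Rightarrow> complex) set" where
  "Xsp p a b = {Phi a b c | c. lp p c}"

definition coef :: "real \<Rightarrow> (int \<Rightarrow> complex) \<Rightarrow> (int \<Rightarrow> complex) \<Rightarrow> (complex \<Rightarrow> complex) \<Rightarrow> int \<Rightarrow> complex" where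
  "coef p a b f = (THE c. lp p c \<and> Phi a b c = f)"

definition Xnorm :: "real \<Rightarrow> (int \<Rightarrow> complex) \<Rightarrow> (int \<Rightarrow> complex) \<Rightarrow> (complex \<Rightarrow> complex) \<Rightarrow> real" where
  "Xnorm p a b f = lp_norm p (coef p a b f)"

definition laurent_coeff :: "complex set \<Rightarrow> (complex \<Rightarrow> complex) \<Rightarrow> int \<Rightarrow> complex" where
  "laurent_coeff \<Omega> f = (THE c. \<forall>z\<in>\<Omega>. ((\<lambda>n. c n * z powi n) has_sum f z) UNIV)"

definition Bw :: "(int \<Rightarrow> complex) \<Rightarrow> complex set \<Rightarrow> (complex \<Rightarrow> complex) \<Rightarrow> complex \<Rightarrow> complex" where
  "Bw w \<Omega> f = (\<lambda>z. if z \<in> \<Omega> then (\<Sum>\<^sub>\<infinity>n. w n * laurent_coeff \<Omega> f n * z powi (n - 1)) else 0)"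

definition hypercyclic_on :: "'a::ab_group_add set \<Rightarrow> ('a \<Rightarrow> real) \<Rightarrow> ('a \<Rightarrow> 'a) \<Rightarrow> bool" where
  "hypercyclic_on S N T = (\<exists>x\<in>S. \<forall>y\<in>S. \<forall>e>0. \<exists>k. (T ^^ k) x \<in> S \<and> N ((T ^^ k) x - y) < e)"

definition periodic_vec :: "'a set \<Rightarrow> ('a \<Rightarrow> 'a) \<Rightarrow> 'a \<Rightarrow> bool" where
  "periodic_vec S T v = (v \<in> S \<and> (\<exists>k::nat. 1 \<le> k \<and> (T ^^ k) v = v))"

definition chaotic_on :: "'a::ab_group_add set \<Rightarrow> ('a \<Rightarrow> real) \<Rightarrow> ('a \<Rightarrow> 'a) \<Rightarrow> bool" where
  "chaotic_on S N T = (hypercyclic_on S N T \<and>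
     (\<forall>y\<in>S. \<forall>e>0. \<exists>v. periodic_vec S T v \<and> N (v - y) < e))"

end

theory Submission
  imports Defs "HOL-Library.Nat_Bijection" "HOL-Library.Real_Mod"
begin

text \<open>
  A function with coordinates \<open>\<lambda>\<close> has Laurent coefficients \<open>a\<^sub>n (\<lambda>\<^sub>n + (b\<^sub>n\<^sub>-\<^sub>1 / a\<^sub>n) \<lambda>\<^sub>n\<^sub>-\<^sub>1)\<close>.
  Since \<open>limsup |b\<^sub>n / a\<^sub>n\<^sub>+\<^sub>1| < 1\<close> and \<open>b\<close> vanishes at negative indices, the map
  \<open>(J \<lambda>)\<^sub>n = \<lambda>\<^sub>n + (b\<^sub>n\<^sub>-\<^sub>1 / a\<^sub>n) \<lambda>\<^sub>n\<^sub>-\<^sub>1\<close> is an isomorphism of \<open>\<ell>\<^sup>p\<close>, so the space is, up to an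
  equivalent norm, the one with \<open>b = 0\<close>. There \<open>B\<^sub>w\<close> is a weighted backward shift; dividing the
  Laurent coefficients by the fixed sequence \<open>u\<^sub>n = w\<^sub>n\<^sub>+\<^sub>1 u\<^sub>n\<^sub>+\<^sub>1\<close>, \<open>u\<^sub>0 = 1\<close>, turns it into the
  unweighted shift on the weighted space \<open>\<ell>\<^sup>p(m)\<close>, \<open>m\<^sub>n = |u\<^sub>n / a\<^sub>n|\<^sup>p\<close>, and condition (iii) says
  \<open>\<Sum> m\<^sub>n < \<infinity>\<close>.

  A nonzero periodic sequence in \<open>\<ell>\<^sup>p(m)\<close> makes \<open>m\<close> summable along a progression, hence everywhere,
  because boundedness of the operator gives \<open>m\<^sub>n \<le> C m\<^sub>n\<^sub>+\<^sub>1\<close>. Conversely, if \<open>m\<close> is summable, all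
  bounded sequences belong to the space, so periodic extensions of finitely supported sequences
  are dense, and a hypercyclic vector is obtained by writing a dense list of finitely supported
  sequences into blocks that are very far apart.
\<close>

section \<open>Summation over the integers\<close>

lemma powr_add_le:
  fixes x y p :: real
  assumes "0 \<le> x" "0 \<le> y" "0 \<le> p"
  shows "(x + y) powr p \<le> 2 powr p * (x powr p + y powr p)"
proof -
  have "(x + y) powr p \<le> (2 * max x y) powr p"
    using assms by (intro powr_mono2) auto
  also have "\<dots> = 2 powr p * (max x y) powr p"
    using assms by (simp add: powr_mult)
  also have "(max x y) powr p \<le> x powr p + y powr p"
    by (simp add: max_def)
  finally show ?thesis by simp
qed

lemma norm_diff_powr_le:
  fixes x y z :: "'a :: real_normed_vector" and p :: real
  assumes "0 \<le> p"
  shows "norm (x - z) powr p \<le> 2 powr p * (norm (x - y) powr p + norm (y - z) powr p)"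
proof -
  have "norm (x - z) powr p \<le> (norm (x - y) + norm (y - z)) powr p"
    using assms norm_triangle_ineq[of "x - y" "y - z"] by (intro powr_mono2) auto
  also have "\<dots> \<le> 2 powr p * (norm (x - y) powr p + norm (y - z) powr p)"
    using assms by (intro powr_add_le) auto
  finally show ?thesis .
qed

text \<open>Used where the factor in front of \<open>x powr p\<close> must stay below one, so that
  the factor \<open>2 powr p\<close> of \<open>powr_add_le\<close> would be fatal. If
  \<open>y\<close> is at most \<open>(\<sigma> - \<rho>) * x\<close>, the sum is at most
  \<open>\<sigma> * x\<close>; otherwise \<open>x\<close> is a bounded multiple of \<open>y\<close>.
  The price is a large constant at \<open>y\<close>.\<close>

lemma add_mult_powr_le:
  fixes x y p \<rho> \<sigma> :: real
  assumes "0 \<le> x" "0 \<le> y" "1 \<le> p" "0 \<le> \<rho>" "\<rho> < \<sigma>" "\<sigma> \<le> 1"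
  shows "(y + \<rho> * x) powr p \<le> (1 + \<rho> / (\<sigma> - \<rho>)) powr p * y powr p + \<sigma> * x powr p"
proof (cases "y \<le> (\<sigma> - \<rho>) * x")
  case True
  have "(y + \<rho> * x) powr p \<le> (\<sigma> * x) powr p"
    using True assms by (intro powr_mono2) (auto simp: algebra_simps)
  also have "\<dots> = \<sigma> powr p * x powr p"
    using assms by (simp add: powr_mult)
  also have "\<sigma> powr p \<le> \<sigma> powr 1"
    using assms by (intro powr_mono') auto
  also have "\<sigma> powr 1 = \<sigma>" using assms by simp
  finally have "(y + \<rho> * x) powr p \<le> \<sigma> * x powr p"
    by (simp add: mult_right_mono)
  then show ?thesis by (simp add: add_increasing)
next
  case False
  then have "x \<le> y / (\<sigma> - \<rho>)" using assms by (simp add: field_simps)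
  then have "\<rho> * x \<le> \<rho> * (y / (\<sigma> - \<rho>))" using assms by (intro mult_left_mono) auto
  then have "(y + \<rho> * x) powr p \<le> ((1 + \<rho> / (\<sigma> - \<rho>)) * y) powr p"
    using assms by (intro powr_mono2) (auto simp: algebra_simps)
  also have "\<dots> = (1 + \<rho> / (\<sigma> - \<rho>)) powr p * y powr p"
    using assms by (simp add: powr_mult)
  finally show ?thesis using assms by (simp add: add_increasing2)
qed

section \<open>Splitting, truncating and reweighting sums over the integers\<close>

lemma summable_on_int_iff:
  fixes f :: "int \<Rightarrow> real"
  assumes "\<And>n. 0 \<le> f n"
  shows "f summable_on UNIV \<longleftrightarrow>
    summable (\<lambda>n. f (int n)) \<and> summable (\<lambda>n. f (- int (Suc n)))"
proof -
  have U: "(UNIV :: int set) = range int \<union> range (\<lambda>n. - int (Suc n))"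
  proof -
    have "x \<in> range int \<union> range (\<lambda>n. - int (Suc n))" for x
      by (cases x) auto
    then show ?thesis by blast
  qed
  have D: "range int \<inter> range (\<lambda>n. - int (Suc n)) = {}" by auto
  have 1: "f summable_on range int \<longleftrightarrow> summable (\<lambda>n. f (int n))"
    by (subst summable_on_reindex, simp, unfold o_def,
        rule summable_on_UNIV_nonneg_real_iff, rule assms)
  have 2: "f summable_on range (\<lambda>n. - int (Suc n)) \<longleftrightarrow> summable (\<lambda>n. f (- int (Suc n)))"
    by (subst summable_on_reindex, simp add: inj_on_def, unfold o_def,
        rule summable_on_UNIV_nonneg_real_iff, rule assms)
  have "f summable_on UNIV \<longleftrightarrow>
      f summable_on range int \<and> f summable_on range (\<lambda>n. - int (Suc n))"
  proof
    assume "f summable_on UNIV"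
    then show "f summable_on range int \<and> f summable_on range (\<lambda>n. - int (Suc n))"
      by (auto intro: summable_on_subset_banach)
  next
    assume "f summable_on range int \<and> f summable_on range (\<lambda>n. - int (Suc n))"
    then show "f summable_on UNIV"
      unfolding U using D by (intro summable_on_Un_disjoint) auto
  qed
  then show ?thesis unfolding 1 2 .
qed

lemma infsum_int_split:
  fixes f :: "int \<Rightarrow> real"
  assumes "f summable_on UNIV"
  shows "infsum f UNIV = infsum f {..<0} + (\<Sum>\<^sub>\<infinity>n. f (int n))"
proof -
  have "infsum f UNIV = infsum f ({..<0} \<union> {0..})"
    by (rule arg_cong[where f="infsum f"]) auto
  also have "\<dots> = infsum f {..<0} + infsum f {0..}"
    using assms by (intro infsum_Un_disjoint) (auto intro: summable_on_subset_banach)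
  also have "infsum f {0..} = infsum f (range int)"
    by (rule arg_cong[where f="infsum f"]) (auto simp: image_iff zero_le_imp_eq_int)
  also have "\<dots> = (\<Sum>\<^sub>\<infinity>n. f (int n))"
    by (subst infsum_reindex) (auto simp: inj_on_def o_def)
  finally show ?thesis .
qed

text \<open>The cutoff \<open>K\<close> depends on the majorant \<open>m\<close> only, so one cutoff
  serves a whole family of error terms. A finite set \<open>F\<close> captures the sum of
  \<open>m\<close> up to \<open>e / 2\<close>, and any \<open>f\<close> vanishing on a window around
  \<open>F\<close> is summed over the complement of \<open>F\<close>.\<close>

lemma infsum_small_tail:
  fixes m :: "int \<Rightarrow> real"
  assumes m: "m summable_on UNIV" and nonneg: "\<And>n. 0 \<le> m n" and e: "0 < e"
  shows "\<exists>K::nat. \<forall>f. (\<forall>n. 0 \<le> f n \<and> f n \<le> m n \<and> (\<bar>n\<bar> < int K \<longrightarrow> f n = 0))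
    \<longrightarrow> infsum f UNIV < e"
proof -
  obtain F where F: "finite F" "dist (sum m F) (infsum m UNIV) \<le> e / 2"
    using infsum_finite_approximation[OF m, of "e / 2"] e by auto
  obtain B where B: "\<And>n. n \<in> F \<Longrightarrow> \<bar>n\<bar> \<le> B"
    using bdd_above_finite[OF finite_imageI[OF F(1), of abs]] by (auto simp: bdd_above_def)
  define K where "K = nat (B + 1)"
  have "infsum f UNIV < e"
    if f: "\<And>n. 0 \<le> f n" "\<And>n. f n \<le> m n" "\<And>n. \<bar>n\<bar> < int K \<Longrightarrow> f n = 0" for f
  proof -
    have fs: "f summable_on UNIV"
      by (rule summable_on_comparison_test[OF m]) (use f in auto)
    have "infsum f UNIV = infsum f (- F)"
    proof (rule infsum_cong_neutral)
      fix x assume "x \<in> UNIV - (- F)"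
      then have "\<bar>x\<bar> \<le> B" using B by auto
      then show "f x = 0" by (intro f(3)) (auto simp: K_def)
    qed auto
    also have "\<dots> \<le> infsum m (- F)"
      using m fs f by (intro infsum_mono) (auto intro: summable_on_subset_banach)
    also have "\<dots> = infsum m UNIV - sum m F"
    proof -
      have "infsum m (F \<union> - F) = infsum m F + infsum m (- F)"
        using m by (intro infsum_Un_disjoint) (auto intro: summable_on_subset_banach)
      then show ?thesis using F(1) by (simp add: Compl_partition)
    qed
    also have "\<dots> \<le> e / 2" using F(2) unfolding dist_real_def by linarith
    finally show ?thesis using e by auto
  qed
  then show ?thesis by (intro exI[of _ K]) blast
qed

text \<open>The weight \<open>1 / sqrt r\<close>, with \<open>r\<close> the tail sum, is summable against \<open>m\<close> because
  \<open>m / sqrt r\<close> is dominated by a telescoping difference of \<open>2 * sqrt r\<close>.\<close>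

lemma summable_unbounded_multiplier_nat:
  fixes m :: "nat \<Rightarrow> real"
  assumes m: "summable m" and pos: "\<And>n. 0 < m n"
  obtains H :: "nat \<Rightarrow> real" where "\<And>n. 0 \<le> H n" "summable (\<lambda>n. H n * m n)"
    "\<And>B. \<exists>K. \<forall>n\<ge>K. B \<le> H n"
proof -
  define r where "r k = (\<Sum>i. m (i + k))" for k
  have rs: "summable (\<lambda>i. m (i + k))" for k
    using m by (simp add: summable_iff_shift)
  have r_pos: "0 < r k" for k
    unfolding r_def using rs pos by (intro suminf_pos) auto
  have r_Suc: "r k = m k + r (Suc k)" for k
    using suminf_split_head[OF rs, of k] by (simp add: r_def)
  have r_lim: "r \<longlonglongrightarrow> 0"
    unfolding r_def using suminf_exist_split2[OF m] by simp
  define H where "H k = 1 / sqrt (r k)" for k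
  have step: "H k * m k \<le> 2 * (sqrt (r k) - sqrt (r (Suc k)))" for k
  proof -
    define s t where "s = sqrt (r k)" and "t = sqrt (r (Suc k))"
    have st: "0 < s" "0 < t" "s\<^sup>2 = r k" "t\<^sup>2 = r (Suc k)"
      using r_pos[of k] r_pos[of "Suc k"] by (auto simp: s_def t_def)
    have "t \<le> s" using r_Suc[of k] pos[of k] by (simp add: s_def t_def)
    have "m k = (s - t) * (s + t)"
      using r_Suc[of k] st by (simp add: algebra_simps power2_eq_square)
    also have "\<dots> \<le> (s - t) * (2 * s)"
      using \<open>t \<le> s\<close> by (intro mult_left_mono) auto
    finally have "H k * m k \<le> (1 / s) * ((s - t) * (2 * s))"
      unfolding H_def s_def[symmetric] using st by (intro mult_left_mono) auto
    then show ?thesis using st by (simp add: s_def t_def)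
  qed
  have H0: "0 \<le> H k" for k using r_pos[of k] by (simp add: H_def)
  have "summable (\<lambda>n. H n * m n)"
  proof (rule bounded_imp_summable)
    fix n
    have "(\<Sum>k\<le>n. H k * m k) \<le> (\<Sum>k\<le>n. 2 * (sqrt (r k) - sqrt (r (Suc k))))"
      by (intro sum_mono step)
    also have "\<dots> = 2 * (sqrt (r 0) - sqrt (r (Suc n)))"
      using sum_telescope[of "\<lambda>k. sqrt (r k)" n] by (simp only: sum_distrib_left[symmetric])
    also have "\<dots> \<le> 2 * sqrt (r 0)" using r_pos[of "Suc n"] by simp
    finally show "(\<Sum>k\<le>n. H k * m k) \<le> 2 * sqrt (r 0)" .
  qed (use H0 pos in \<open>simp add: less_imp_le\<close>)
  moreover have "\<exists>K. \<forall>n\<ge>K. B \<le> H n" for B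
  proof -
    define C where "C = max B 1"
    have "0 < 1 / C\<^sup>2" by (simp add: C_def)
    from order_tendstoD(2)[OF r_lim this]
    obtain K where K: "\<And>n. n \<ge> K \<Longrightarrow> r n < 1 / C\<^sup>2"
      by (auto simp: eventually_sequentially)
    have "B \<le> H n" if "n \<ge> K" for n
    proof -
      have "sqrt (r n) \<le> sqrt (1 / C\<^sup>2)" using K[OF that] by simp
      also have "\<dots> = 1 / C" by (simp add: real_sqrt_divide C_def)
      finally have "C \<le> H n"
        using r_pos[of n] by (simp add: H_def field_simps C_def max_def split: if_splits)
      then show ?thesis by (simp add: C_def)
    qed
    then show ?thesis by auto
  qed
  ultimately show ?thesis using that[of H] H0 by blast
qed

lemma abs_le_int_encode: "\<bar>n\<bar> \<le> int (int_encode n)"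
  by (auto simp: int_encode_def sum_encode_def)

text \<open>Enumerating the integers reduces this to sequences, and \<open>abs_le_int_encode\<close>
  makes \<open>H\<close> grow at both ends. \<open>H\<close> later serves as an error majorant that
  eventually exceeds any prescribed block size and is still summable against
  \<open>m\<close>.\<close>

lemma summable_unbounded_multiplier_int:
  fixes m :: "int \<Rightarrow> real"
  assumes m: "m summable_on UNIV" and pos: "\<And>n. 0 < m n"
  obtains H :: "int \<Rightarrow> real" where "\<And>n. 0 \<le> H n" "(\<lambda>n. H n * m n) summable_on UNIV"
    "\<And>B. \<exists>K. \<forall>n. int K \<le> \<bar>n\<bar> \<longrightarrow> B \<le> H n"
proof -
  have "(\<lambda>k. m (int_decode k)) summable_on UNIV"
    using m summable_on_reindex_bij_betw[OF bij_int_decode, of m] by simp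
  then have s: "summable (\<lambda>k. m (int_decode k))"
    by (rule summable_on_imp_summable)
  obtain H where H: "\<And>n. 0 \<le> H n" "summable (\<lambda>k. H k * m (int_decode k))"
    "\<And>B. \<exists>K. \<forall>n\<ge>K. B \<le> H n"
    using summable_unbounded_multiplier_nat[OF s pos] by blast
  have "(\<lambda>k. H k * m (int_decode k)) summable_on UNIV"
    using H pos by (subst summable_on_UNIV_nonneg_real_iff) (auto simp: less_imp_le)
  then have "(\<lambda>n. H (int_encode n) * m n) summable_on UNIV"
    using summable_on_reindex_bij_betw[OF bij_int_encode, of "\<lambda>k. H k * m (int_decode k)"] by simp
  moreover have "\<exists>K. \<forall>n. int K \<le> \<bar>n\<bar> \<longrightarrow> B \<le> H (int_encode n)" for B
  proof -
    obtain K where "\<forall>n\<ge>K. B \<le> H n" using H(3) by blast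
    moreover have "K \<le> int_encode n" if "int K \<le> \<bar>n\<bar>" for n
      using that abs_le_int_encode[of n] by simp
    ultimately show ?thesis by blast
  qed
  ultimately show ?thesis using that[of "\<lambda>n. H (int_encode n)"] H(1) by blast
qed

section \<open>The shift on a weighted sequence space\<close>

locale summable_weight =
  fixes p :: real and m :: "int \<Rightarrow> real"
  assumes p_pos: "0 < p" and m_pos: "0 < m n" and m_summable: "m summable_on UNIV"
begin

definition wlp :: "(int \<Rightarrow> complex) \<Rightarrow> bool" where
  "wlp t \<longleftrightarrow> (\<lambda>n. norm (t n) powr p * m n) summable_on UNIV"

text \<open>This is the p-th power of the weighted norm. Without the root, sums can be estimated
  termwise, and the triangle inequality holds up to the factor \<open>2 powr p\<close>.\<close>

definition modular :: "(int \<Rightarrow> complex) \<Rightarrow> real" where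
  "modular t = (\<Sum>\<^sub>\<infinity>n. norm (t n) powr p * m n)"

lemma m_nonneg: "0 \<le> m n"
  using m_pos[of n] by simp

lemma wlp_mono:
  assumes "f summable_on UNIV" "\<And>n. norm (t n) powr p * m n \<le> f n"
  shows "wlp t"
  unfolding wlp_def
  by (rule summable_on_comparison_test[OF assms(1)]) (use assms(2) m_nonneg in auto)

lemma modular_mono:
  assumes "f summable_on UNIV" "\<And>n. norm (t n) powr p * m n \<le> f n"
  shows "modular t \<le> infsum f UNIV"
  unfolding modular_def
  by (rule infsum_mono) (use wlp_mono[of f t] assms in \<open>auto simp: wlp_def\<close>)

lemma wlp_bounded:
  assumes "\<And>n. norm (t n) powr p \<le> B"
  shows "wlp t"
proof (rule wlp_mono)
  show "(\<lambda>n. B * m n) summable_on UNIV"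
    using m_summable by (rule summable_on_cmult_right)
  show "norm (t n) powr p * m n \<le> B * m n" for n
    using assms m_nonneg by (intro mult_right_mono) auto
qed

lemma modular_triangle:
  assumes "wlp (\<lambda>n. x n - y n)" "wlp (\<lambda>n. y n - z n)"
  shows wlp_triangle: "wlp (\<lambda>n. x n - z n)"
    and "modular (\<lambda>n. x n - z n)
      \<le> 2 powr p * (modular (\<lambda>n. x n - y n) + modular (\<lambda>n. y n - z n))"
proof -
  let ?f = "\<lambda>n. 2 powr p * (norm (x n - y n) powr p * m n + norm (y n - z n) powr p * m n)"
  have s: "?f summable_on UNIV"
    using assms unfolding wlp_def by (intro summable_on_cmult_right summable_on_add)
  have le: "norm (x n - z n) powr p * m n \<le> ?f n" for n
  proof -
    have "norm (x n - z n) powr p * m n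
        \<le> (2 powr p * (norm (x n - y n) powr p + norm (y n - z n) powr p)) * m n"
      using p_pos m_nonneg by (intro mult_right_mono norm_diff_powr_le) auto
    then show ?thesis by (simp add: algebra_simps)
  qed
  show "wlp (\<lambda>n. x n - z n)" by (rule wlp_mono[OF s le])
  have "infsum ?f UNIV
      = 2 powr p * (modular (\<lambda>n. x n - y n) + modular (\<lambda>n. y n - z n))"
    unfolding modular_def using assms unfolding wlp_def
    by (simp add: infsum_cmult_right' infsum_add)
  then show "modular (\<lambda>n. x n - z n)
      \<le> 2 powr p * (modular (\<lambda>n. x n - y n) + modular (\<lambda>n. y n - z n))"
    using modular_mono[OF s le] by simp
qed

lemma wlp_diff:
  assumes "wlp x" "wlp y"
  shows "wlp (\<lambda>n. x n - y n)"
  using wlp_triangle[of x "\<lambda>_. 0" y] assms by (simp add: wlp_def)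

section \<open>Dense sequences, a dense orbit and dense periodic points of the unweighted
  shift\<close>

lemma small_powr_ex:
  assumes "0 < e"
  shows "\<exists>d>0. d powr p < e"
proof -
  have "((e / 2) powr (1 / p)) powr p = e / 2"
    using assms p_pos by (simp add: powr_powr)
  then show ?thesis using assms by (intro exI[of _ "(e / 2) powr (1 / p)"]) auto
qed

text \<open>Finite lists with entries in a countable dense set of complex numbers are enumerated.
  The clause \<open>j\<ge>J\<close> asks for approximation arbitrarily late in the list, because a
  late block in the hypercyclic vector is the one whose error is small. A single \<open>N\<close>
  bounds both the support and the p-th powers of the values.\<close>

lemma ex_dense_sequence:
  "\<exists>g :: nat \<Rightarrow> int \<Rightarrow> complex.
    (\<forall>j. \<exists>N::nat. \<forall>n. (int N < \<bar>n\<bar> \<longrightarrow> g j n = 0) \<and> norm (g j n) powr p \<le> real N) \<and>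
    (\<forall>t e J. wlp t \<longrightarrow> 0 < e \<longrightarrow> (\<exists>j\<ge>J. modular (\<lambda>n. g j n - t n) < e))"
proof -
  obtain D :: "complex set" where D: "countable D"
    "\<And>X. open X \<Longrightarrow> X \<noteq> {} \<Longrightarrow> \<exists>d\<in>D. d \<in> X"
    by (rule countable_dense_setE) blast
  have "D \<noteq> {}" using D(2)[of UNIV] by auto
  define q where "q = from_nat_into D"
  have q: "\<exists>i. norm (q i - z) < d" if d: "0 < d" for z d
  proof -
    have "ball z d \<noteq> {}" using d by simp
    then obtain x where x: "x \<in> D" "x \<in> ball z d" using D(2)[of "ball z d"] by auto
    then obtain i where "q i = x"
      using D(1) from_nat_into_surj unfolding q_def by metis
    with x(2) show ?thesis by (intro exI[of _ i]) (auto simp: dist_norm norm_minus_commute)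
  qed
  \<comment> \<open>Only the first component of the pair coded by \<open>j\<close> determines the
    sequence; the second is padding that makes every list recur beyond any index.\<close>
  define g where "g j n = (let L = list_decode (fst (prod_decode j)) in
      if int_encode n < length L then q (L ! int_encode n) else 0)" for j n
  have g1: "\<exists>N::nat. \<forall>n. (int N < \<bar>n\<bar> \<longrightarrow> g j n = 0) \<and> norm (g j n) powr p \<le> real N" for j
  proof -
    define L where "L = list_decode (fst (prod_decode j))"
    define S where "S = (\<Sum>i<length L. norm (q (L ! i)) powr p)"
    define N where "N = nat \<lceil>S\<rceil> + length L"
    have "S \<ge> 0" unfolding S_def by (intro sum_nonneg) auto
    then have SN: "S \<le> real N" unfolding N_def using real_nat_ceiling_ge[of S] by linarith
    have "norm (g j n) powr p \<le> real N" for n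
    proof (cases "int_encode n < length L")
      case True
      then have "norm (q (L ! int_encode n)) powr p \<le> S"
        unfolding S_def by (intro member_le_sum) auto
      then show ?thesis using True SN by (simp add: g_def L_def[symmetric])
    qed (simp add: g_def L_def[symmetric])
    moreover have "g j n = 0" if "int N < \<bar>n\<bar>" for n
    proof -
      have "length L \<le> int_encode n" using abs_le_int_encode[of n] that unfolding N_def by linarith
      then show ?thesis by (simp add: g_def L_def[symmetric])
    qed
    ultimately show ?thesis by blast
  qed
  have g2: "\<exists>j\<ge>J. modular (\<lambda>n. g j n - t n) < e" if t: "wlp t" and e: "0 < e" for t e J
  proof -
    let ?M = "infsum m UNIV"
    have M: "0 \<le> ?M" by (intro infsum_nonneg m_nonneg)
    \<comment> \<open>With this \<open>d\<close>, the total error on the listed indices is at most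
      \<open>d powr p * ?M\<close>, hence at most \<open>e / 2\<close>; the other half of
      \<open>e\<close> is for the tail of \<open>t\<close>.\<close>
    obtain d where d: "0 < d" "d powr p < e / (2 * (?M + 1))"
      using small_powr_ex[of "e / (2 * (?M + 1))"] e M by auto
    have "\<exists>K::nat. \<forall>f. (\<forall>n. 0 \<le> f n \<and> f n \<le> norm (t n) powr p * m n \<and> (\<bar>n\<bar> < int K \<longrightarrow> f n = 0))
        \<longrightarrow> infsum f UNIV < e / 2"
      by (rule infsum_small_tail) (use t e m_nonneg wlp_def in auto)
    then obtain K :: nat where K: "\<And>f. \<forall>n. 0 \<le> f n \<and> f n \<le> norm (t n) powr p * m n \<and> (\<bar>n\<bar> < int K \<longrightarrow> f n = 0)
        \<Longrightarrow> infsum f UNIV < e / 2"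
      by blast
    have "\<forall>n. \<exists>k. norm (q k - t n) < d" using q[OF d(1)] by blast
    from choice[OF this] obtain i where i: "\<And>n. norm (q (i n) - t n) < d" by blast
    \<comment> \<open>The length is large enough for the codes of all \<open>n\<close> with
      \<open>\<bar>n\<bar> < int K\<close>, so that unlisted indices lie in the tail of
      \<open>t\<close>.\<close>
    define L where "L = map (\<lambda>k. i (int_decode k)) [0..<2 * K + 2]"
    define j where "j = prod_encode (list_encode L, J)"
    have gj: "g j n = (if int_encode n < length L then q (i n) else 0)" for n
      by (auto simp: g_def j_def L_def simp del: upt_Suc)
    have len: "int_encode n < length L" if "\<bar>n\<bar> < int K" for n
      using that by (auto simp: L_def int_encode_def sum_encode_def)
    define f where "f n = (if int_encode n < length L then 0 else norm (t n) powr p * m n)" for n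
    have f0: "0 \<le> f n" "f n \<le> norm (t n) powr p * m n" for n
      using m_nonneg by (auto simp: f_def)
    have fK: "infsum f UNIV < e / 2"
      by (rule K) (use f0 len in \<open>auto simp: f_def\<close>)
    have fs: "f summable_on UNIV"
      by (rule summable_on_comparison_test[OF t[unfolded wlp_def]]) (use f0 in auto)
    have s: "(\<lambda>n. d powr p * m n + f n) summable_on UNIV"
      by (intro summable_on_add summable_on_cmult_right m_summable fs)
    have "modular (\<lambda>n. g j n - t n) \<le> (\<Sum>\<^sub>\<infinity>n. d powr p * m n + f n)"
    proof (rule modular_mono[OF s])
      fix n
      have "norm (q (i n) - t n) powr p * m n \<le> d powr p * m n"
        using i[of n] p_pos m_nonneg by (intro mult_right_mono powr_mono2) auto
      then show "norm (g j n - t n) powr p * m n \<le> d powr p * m n + f n"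
        using m_nonneg by (auto simp: gj f_def)
    qed
    also have "\<dots> = d powr p * ?M + infsum f UNIV"
      using m_summable fs by (simp add: infsum_add infsum_cmult_right' summable_on_cmult_right)
    also have "\<dots> < e / 2 + e / 2"
    proof -
      have "d powr p * ?M \<le> e / (2 * (?M + 1)) * ?M"
        using d(2) M by (intro mult_right_mono) auto
      also have "\<dots> \<le> e / 2" using M e by (simp add: field_simps)
      finally show ?thesis using fK by linarith
    qed
    finally have "modular (\<lambda>n. g j n - t n) < e" by simp
    moreover have "J \<le> j" unfolding j_def by (rule le_prod_encode_2)
    ultimately show ?thesis by blast
  qed
  show ?thesis using g1 g2 by (intro exI[of _ g]) blast
qed

text \<open>The vector \<open>x\<close> carries a copy of \<open>g i\<close> centred at
  \<open>pos i\<close> for every \<open>i\<close>. Shifting by \<open>pos j\<close> brings block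
  \<open>j\<close> to the origin. Every other block then sits so far out that its values are
  dominated by \<open>H\<close>, and the tail of the summable \<open>H n * m n\<close> bounds the
  error.\<close>

lemma ex_dense_shift_orbit:
  "\<exists>x. wlp x \<and> (\<forall>t e. wlp t \<longrightarrow> 0 < e \<longrightarrow> (\<exists>k::nat. modular (\<lambda>n. x (n + int k) - t n) < e))"
proof -
  obtain g :: "nat \<Rightarrow> int \<Rightarrow> complex" where
    g_fin: "\<forall>j. \<exists>N::nat. \<forall>n. (int N < \<bar>n\<bar> \<longrightarrow> g j n = 0) \<and> norm (g j n) powr p \<le> real N"
    and g_dense: "\<forall>t e J. wlp t \<longrightarrow> 0 < e \<longrightarrow> (\<exists>j\<ge>J. modular (\<lambda>n. g j n - t n) < e)"
    using ex_dense_sequence by (elim exE conjE)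
  from choice[OF g_fin] obtain N :: "nat \<Rightarrow> nat" where
    N: "\<And>j n. int (N j) < \<bar>n\<bar> \<Longrightarrow> g j n = 0" "\<And>j n. norm (g j n) powr p \<le> real (N j)"
    by blast
  obtain H where H: "\<And>n. 0 \<le> H n" "(\<lambda>n. H n * m n) summable_on UNIV"
    "\<And>B. \<exists>K. \<forall>n. int K \<le> \<bar>n\<bar> \<longrightarrow> B \<le> H n"
    using summable_unbounded_multiplier_int[OF m_summable m_pos] by blast
  \<comment> \<open>A monotone majorant of \<open>N\<close>: it bounds support and values of all
    blocks up to \<open>j\<close> at once.\<close>
  define B where "B j = (\<Sum>i\<le>j. N i)" for j
  have NB: "N i \<le> B j" if "i \<le> j" for i j
    unfolding B_def using that by (intro member_le_sum) auto
  obtain \<kappa> where \<kappa>: "\<And>j n. int (\<kappa> j) \<le> \<bar>n\<bar> \<Longrightarrow> real (B j) \<le> H n"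
    using choice[of "\<lambda>j K. \<forall>n. int K \<le> \<bar>n\<bar> \<longrightarrow> real (B j) \<le> H n"] H(3) by blast
  \<comment> \<open>The summand \<open>2 * B l\<close> leaves room for the radii of two blocks,
    \<open>\<kappa> l\<close> pushes the blocks to where \<open>H\<close> exceeds their values, and
    \<open>l\<close> makes the distance tend to infinity.\<close>
  define pos where "pos j = (\<Sum>l\<le>j. \<kappa> l + l + 2 * B l + 1)" for j
  have gap: "pos i + \<kappa> j + j + N i + N j < pos j" if "i < j" for i j
  proof -
    have "pos i + (\<kappa> j + j + 2 * B j + 1) = (\<Sum>l\<in>insert j {..i}. \<kappa> l + l + 2 * B l + 1)"
      using that by (simp add: pos_def)
    also have "\<dots> \<le> pos j"
      unfolding pos_def using that by (intro sum_mono2) auto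
    finally show ?thesis using NB[of i j] NB[of j j] that by simp
  qed
  define block where "block n i \<longleftrightarrow> \<bar>n - int (pos i)\<bar> \<le> int (N i)" for n i
  have uniq: "i = j" if "block n i" "block n j" for n i j
    using gap[of i j] gap[of j i] that unfolding block_def by linarith
  define x where "x n = (if \<exists>i. block n i then g (THE i. block n i) (n - int (pos (THE i. block n i))) else 0)" for n
  have x_block: "x n = g i (n - int (pos i))" if "block n i" for n i
  proof -
    have "(THE i. block n i) = i" using that uniq by (intro the_equality) auto
    then show ?thesis using that by (auto simp: x_def)
  qed
  \<comment> \<open>After the shift either the value is exact, or the index is at least
    \<open>j\<close> away from the origin and \<open>H\<close> dominates the error.\<close>
  have err: "x (n + int (pos j)) = g j n \<or>
      int j \<le> \<bar>n\<bar> \<and> norm (x (n + int (pos j)) - g j n) powr p \<le> H n" for n j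
  proof (cases "block (n + int (pos j)) j")
    case True
    then show ?thesis using x_block[OF True] by simp
  next
    case False
    then have g0: "g j n = 0" by (intro N(1)) (simp add: block_def)
    show ?thesis
    proof (cases "\<exists>i. block (n + int (pos j)) i")
      case True
      then obtain i where i: "block (n + int (pos j)) i" by blast
      then have ij: "i \<noteq> j" using False by auto
      \<comment> \<open>The gap between two blocks is governed by the later one, whichever of the
        two has been moved to the origin.\<close>
      define l where "l = max i j"
      have l: "int (\<kappa> l) + int l \<le> \<bar>n\<bar>"
        using gap[of i j] gap[of j i] ij i unfolding block_def l_def by (cases "i < j") auto
      have "norm (x (n + int (pos j))) powr p \<le> real (N i)"
        using x_block[OF i] N(2) by simp
      also have "\<dots> \<le> real (B l)" using NB[of i l] by (simp add: l_def)
      also have "\<dots> \<le> H n" using l by (intro \<kappa>) simp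
      finally show ?thesis using l g0 by (auto simp: l_def)
    qed (simp add: x_def g0)
  qed
  have Hle: "norm (x (n + int (pos j)) - g j n) powr p * m n \<le> H n * m n" for n j
    using err[of n j] H(1)[of n] m_nonneg[of n] by (auto intro: mult_right_mono)
  have w_err: "wlp (\<lambda>n. x (n + int (pos j)) - g j n)" for j
    by (rule wlp_mono[OF H(2) Hle])
  have w_g: "wlp (g j)" for j
    by (rule wlp_bounded[OF N(2)])
  have "wlp x"
  proof -
    \<comment> \<open>\<open>gap\<close> compares a block with an earlier one and so does not apply
      to block 0, which gets the separate majorant \<open>real (N 0) * m n\<close>.\<close>
    have "norm (x n) powr p * m n \<le> H n * m n + real (N 0) * m n" for n
    proof (cases "\<exists>i. block n i")
      case True
      then obtain i where i: "block n i" by blast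
      have le: "norm (x n) powr p \<le> real (N i)" using x_block[OF i] N(2) by simp
      show ?thesis
      proof (cases "i = 0")
        case True
        then have "norm (x n) powr p * m n \<le> real (N 0) * m n"
          using le m_nonneg by (intro mult_right_mono) auto
        then show ?thesis using H(1)[of n] m_nonneg[of n] by (simp add: add_increasing)
      next
        case False
        have "int (\<kappa> i) \<le> \<bar>n\<bar>"
          using gap[of 0 i] False i unfolding block_def by linarith
        from \<kappa>[OF this] have "norm (x n) powr p \<le> H n"
          using le NB[of i i] by simp
        then have "norm (x n) powr p * m n \<le> H n * m n"
          using m_nonneg by (intro mult_right_mono) auto
        then show ?thesis using m_nonneg[of n] by (simp add: add_increasing2)
      qed
    qed (use H(1)[of n] m_nonneg[of n] p_pos in \<open>simp add: x_def\<close>)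
    then show ?thesis
      by (intro wlp_mono[of "\<lambda>n. H n * m n + real (N 0) * m n"] summable_on_add H(2)
          summable_on_cmult_right m_summable)
  qed
  moreover have "\<exists>k::nat. modular (\<lambda>n. x (n + int k) - t n) < e" if t: "wlp t" and e: "0 < e" for t e
  proof -
    define \<epsilon> where "\<epsilon> = e / (2 * 2 powr p)"
    have \<epsilon>: "0 < \<epsilon>" using e by (simp add: \<epsilon>_def)
    have "\<exists>K::nat. \<forall>f. (\<forall>n. 0 \<le> f n \<and> f n \<le> H n * m n \<and> (\<bar>n\<bar> < int K \<longrightarrow> f n = 0))
        \<longrightarrow> infsum f UNIV < \<epsilon>"
      by (rule infsum_small_tail) (use H m_nonneg \<epsilon> in auto)
    then obtain K :: nat where K: "\<And>f. \<forall>n. 0 \<le> f n \<and> f n \<le> H n * m n \<and> (\<bar>n\<bar> < int K \<longrightarrow> f n = 0)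
        \<Longrightarrow> infsum f UNIV < \<epsilon>"
      by blast
    obtain j where j: "K \<le> j" "modular (\<lambda>n. g j n - t n) < \<epsilon>"
      using g_dense t \<epsilon> by blast
    have "modular (\<lambda>n. x (n + int (pos j)) - g j n) < \<epsilon>"
      unfolding modular_def
    proof (rule K, intro allI conjI impI)
      show "norm (x (n + int (pos j)) - g j n) powr p * m n = 0" if "\<bar>n\<bar> < int K" for n
        using err[of n j] that j(1) p_pos by auto
    qed (use Hle m_nonneg in auto)
    then have "modular (\<lambda>n. x (n + int (pos j)) - g j n) + modular (\<lambda>n. g j n - t n) < 2 * \<epsilon>"
      using j(2) by simp
    then have "2 powr p * (modular (\<lambda>n. x (n + int (pos j)) - g j n) + modular (\<lambda>n. g j n - t n))
        < 2 powr p * (2 * \<epsilon>)"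
      by (intro mult_strict_left_mono) auto
    also have "\<dots> = e" by (simp add: \<epsilon>_def)
    finally have "modular (\<lambda>n. x (n + int (pos j)) - t n) < e"
      using modular_triangle(2)[OF w_err[of j] wlp_diff[OF w_g[of j] t]] by linarith
    then show ?thesis by blast
  qed
  ultimately show ?thesis by blast
qed

text \<open>A finitely supported approximation of \<open>t\<close> is repeated with a long period.
  The copies are bounded, and they lie where the tail of \<open>m\<close> is small.\<close>

lemma periodic_dense:
  assumes t: "wlp t" and e: "0 < e"
  shows "\<exists>v. \<exists>k::nat. 1 \<le> k \<and> (\<forall>n. v (n + int k) = v n) \<and> wlp v \<and>
    modular (\<lambda>n. v n - t n) < e"
proof -
  define \<epsilon> where "\<epsilon> = e / (2 * 2 powr p)"
  have \<epsilon>: "0 < \<epsilon>" using e by (simp add: \<epsilon>_def)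
  obtain g :: "nat \<Rightarrow> int \<Rightarrow> complex" where
    g_fin: "\<forall>j. \<exists>N::nat. \<forall>n. (int N < \<bar>n\<bar> \<longrightarrow> g j n = 0) \<and> norm (g j n) powr p \<le> real N"
    and g_dense: "\<forall>t e J. wlp t \<longrightarrow> 0 < e \<longrightarrow> (\<exists>j\<ge>J. modular (\<lambda>n. g j n - t n) < e)"
    using ex_dense_sequence by (elim exE conjE)
  obtain j where j: "modular (\<lambda>n. g j n - t n) < \<epsilon>"
    using g_dense t \<epsilon> by blast
  obtain N :: nat where N: "\<And>n. int N < \<bar>n\<bar> \<Longrightarrow> g j n = 0" "\<And>n. norm (g j n) powr p \<le> real N"
    using g_fin by blast
  have Nm: "(\<lambda>n. real N * m n) summable_on UNIV"
    by (intro summable_on_cmult_right m_summable)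
  have "\<exists>K0::nat. \<forall>f. (\<forall>n. 0 \<le> f n \<and> f n \<le> real N * m n \<and> (\<bar>n\<bar> < int K0 \<longrightarrow> f n = 0))
        \<longrightarrow> infsum f UNIV < \<epsilon>"
      by (rule infsum_small_tail) (use Nm m_nonneg \<epsilon> in auto)
    then obtain K0 :: nat where K0: "\<And>f. \<forall>n. 0 \<le> f n \<and> f n \<le> real N * m n \<and> (\<bar>n\<bar> < int K0 \<longrightarrow> f n = 0)
        \<Longrightarrow> infsum f UNIV < \<epsilon>"
      by blast
  \<comment> \<open>The window from \<open>-K\<close> to \<open>K\<close> contains the support of
    \<open>g j\<close> and reaches the tail of \<open>m\<close>; its length \<open>2 * K + 1\<close>
    is the period.\<close>
  define K where "K = int (max K0 N)"
  define v where "v n = g j ((n + K) mod (2 * K + 1) - K)" for n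
  have vg: "v n = g j n" if "\<bar>n\<bar> \<le> K" for n
    using that by (simp add: v_def mod_pos_pos_trivial)
  have v_le: "norm (v n) powr p \<le> real N" for n
    unfolding v_def by (rule N(2))
  have w_v: "wlp v" by (rule wlp_bounded[OF v_le])
  have w_g: "wlp (g j)" by (rule wlp_bounded[OF N(2)])
  have "modular (\<lambda>n. v n - g j n) < \<epsilon>"
    unfolding modular_def
  proof (rule K0, intro allI conjI impI)
    show "norm (v n - g j n) powr p * m n \<le> real N * m n" for n
    proof (cases "\<bar>n\<bar> \<le> K")
      case False
      then have "g j n = 0" by (intro N(1)) (simp add: K_def)
      then show ?thesis using v_le[of n] m_nonneg by (simp add: mult_right_mono)
    qed (use m_nonneg in \<open>simp add: vg\<close>)
    show "norm (v n - g j n) powr p * m n = 0" if "\<bar>n\<bar> < int K0" for n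
      using that by (simp add: vg K_def)
  qed (use m_nonneg in auto)
  then have "modular (\<lambda>n. v n - g j n) + modular (\<lambda>n. g j n - t n) < 2 * \<epsilon>"
    using j by simp
  then have "2 powr p * (modular (\<lambda>n. v n - g j n) + modular (\<lambda>n. g j n - t n))
      < 2 powr p * (2 * \<epsilon>)"
    by (intro mult_strict_left_mono) auto
  also have "\<dots> = e" by (simp add: \<epsilon>_def)
  finally have "modular (\<lambda>n. v n - t n) < e"
    using modular_triangle(2)[OF wlp_diff[OF w_v w_g] wlp_diff[OF w_g t]] by linarith
  moreover have "v (n + int (nat (2 * K + 1))) = v n" for n
  proof -
    have "n + int (nat (2 * K + 1)) + K = (n + K) + (2 * K + 1)"
      by (simp add: K_def)
    then show ?thesis unfolding v_def by (metis mod_add_self2)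
  qed
  moreover have "1 \<le> nat (2 * K + 1)" by (simp add: K_def)
  ultimately show ?thesis using w_v by blast
qed

end

section \<open>Sequence spaces and a linear recursion\<close>

text \<open>The weights \<open>v k\<close> absorb the finitely many coefficients \<open>\<sigma> k\<close> that exceed \<open>\<rho>\<close>.\<close>

lemma sum_recursive_le:
  fixes X Y \<sigma> :: "nat \<Rightarrow> real"
  assumes \<rho>: "0 < \<rho>" "\<rho> < 1" and D: "1 \<le> D" and A: "1 \<le> A"
    and \<sigma>_tail: "\<And>k. n0 \<le> k \<Longrightarrow> \<sigma> k \<le> \<rho>" and \<sigma>_le: "\<And>k. \<sigma> k \<le> D"
    and X: "\<And>k. 0 \<le> X k" and Y: "\<And>k. 0 \<le> Y k"
    and X0: "X 0 \<le> A * Y 0" and XS: "\<And>k. X (Suc k) \<le> A * Y (Suc k) + \<sigma> k * X k"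
  shows "(\<Sum>k\<le>N. X k) \<le> A / ((1 - \<rho>) * (\<rho> / D) ^ n0) * (\<Sum>k\<le>N. Y k)"
proof -
  define c where "c = \<rho> / D"
  have c: "0 < c" "c \<le> 1" using \<rho> D by (auto simp: c_def)
  define v where "v k = c ^ min k n0" for k
  have v: "0 < v k" "v k \<le> 1" "c ^ n0 \<le> v k" for k
    using c by (auto simp: v_def power_le_one intro!: power_decreasing)
  have \<sigma>v: "\<sigma> k * v (Suc k) \<le> \<rho> * v k" for k
  proof (cases "n0 \<le> k")
    case True
    then have "v (Suc k) = v k" by (simp add: v_def)
    then show ?thesis using \<sigma>_tail[OF True] v[of k] by (simp add: mult_right_mono)
  next
    case False
    then have "v (Suc k) = c * v k" by (simp add: v_def min_def)
    moreover have "\<sigma> k * (c * v k) \<le> D * (c * v k)"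
      using \<sigma>_le[of k] c v[of k] by (intro mult_right_mono) auto
    ultimately show ?thesis using D by (simp add: c_def)
  qed
  define S where "S = (\<Sum>k\<le>N. v k * X k)"
  define T where "T = (\<Sum>k\<le>N. Y k)"
  have "S \<le> A * T + \<rho> * S"
  \<comment> \<open>The weighted recursion loses a factor \<open>\<rho>\<close> at every step, so
    summing it gives back \<open>S\<close> with a factor below one, which can be absorbed on the
    left.\<close>
  proof -
    have vY: "v k * (A * Y k) \<le> A * Y k" for k
      using v[of k] A Y[of k] by (simp add: mult_left_le_one_le)
    have step: "v (Suc k) * X (Suc k) \<le> A * Y (Suc k) + \<rho> * (v k * X k)" for k
    proof -
      have "v (Suc k) * X (Suc k) \<le> v (Suc k) * (A * Y (Suc k)) + (\<sigma> k * v (Suc k)) * X k"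
        using mult_left_mono[OF XS[of k], of "v (Suc k)"] v[of "Suc k"] by (simp add: algebra_simps)
      also have "(\<sigma> k * v (Suc k)) * X k \<le> (\<rho> * v k) * X k"
        using \<sigma>v X by (intro mult_right_mono) auto
      finally show ?thesis using vY[of "Suc k"] by simp
    qed
    have 0: "v 0 * X 0 \<le> A * Y 0"
      using mult_left_mono[OF X0, of "v 0"] v[of 0] vY[of 0] by linarith
    have "S \<le> A * T + \<rho> * (\<Sum>k<N. v k * X k)"
    proof (cases N)
      case 0
      then show ?thesis using \<open>v 0 * X 0 \<le> A * Y 0\<close> by (simp add: S_def T_def)
    next
      case (Suc M)
      have "S = v 0 * X 0 + (\<Sum>k\<le>M. v (Suc k) * X (Suc k))"
        by (simp only: S_def Suc sum.atMost_Suc_shift)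
      also have "\<dots> \<le> A * Y 0 + (\<Sum>k\<le>M. A * Y (Suc k) + \<rho> * (v k * X k))"
        by (intro add_mono 0 sum_mono step)
      also have "\<dots> = A * T + \<rho> * (\<Sum>k\<le>M. v k * X k)"
        by (simp only: T_def Suc sum.atMost_Suc_shift sum.distrib sum_distrib_left distrib_left add.assoc)
      finally show ?thesis by (simp add: Suc lessThan_Suc_atMost)
    qed
    moreover have "\<rho> * (\<Sum>k<N. v k * X k) \<le> \<rho> * S"
      unfolding S_def using v X \<rho> by (intro mult_left_mono sum_mono2) (auto simp: less_imp_le)
    ultimately show ?thesis by linarith
  qed
  then have ST: "S \<le> A / (1 - \<rho>) * T" using \<rho> by (simp add: field_simps)
  \<comment> \<open>Removing the weights costs their smallest value \<open>c ^ n0\<close>.\<close>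
  have "c ^ n0 * (\<Sum>k\<le>N. X k) \<le> S"
    unfolding S_def sum_distrib_left using v X by (intro sum_mono mult_right_mono) auto
  with ST have "c ^ n0 * (\<Sum>k\<le>N. X k) \<le> A / (1 - \<rho>) * T" by simp
  moreover have "0 < c ^ n0" using c by simp
  ultimately have "(\<Sum>k\<le>N. X k) \<le> A / (1 - \<rho>) * T / c ^ n0"
    by (subst pos_le_divide_eq) (simp_all add: mult.commute)
  then show ?thesis by (simp add: T_def c_def)
qed

section \<open>Stability of the space of p-summable sequences, and solving the recursion in
  it\<close>

lemma lp_mono:
  assumes "lp p c" "0 \<le> p" "0 \<le> B" "\<And>n. norm (d n) \<le> B * norm (c n)"
  shows "lp p d"
  unfolding lp_def
proof (rule summable_on_comparison_test)
  show "(\<lambda>n. B powr p * norm (c n) powr p) summable_on UNIV"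
    using assms(1) unfolding lp_def by (rule summable_on_cmult_right)
  show "norm (d n) powr p \<le> B powr p * norm (c n) powr p" for n
    using powr_mono2[OF assms(2) _ assms(4), of n] assms(2,3) by (simp add: powr_mult)
qed auto

lemma lp_shift:
  assumes "lp p c"
  shows "lp p (\<lambda>n. c (n + k))"
  using assms summable_on_reindex_bij_betw[of "\<lambda>n. n + k" UNIV UNIV "\<lambda>n. norm (c n) powr p"]
  unfolding lp_def by (simp add: bij_plus_right)

lemma lp_diff:
  assumes "lp p c" "lp p d" "0 \<le> p"
  shows "lp p (\<lambda>n. c n - d n)"
  unfolding lp_def
proof (rule summable_on_comparison_test)
  show "(\<lambda>n. 2 powr p * (norm (c n) powr p + norm (d n) powr p)) summable_on UNIV"
    using assms unfolding lp_def by (intro summable_on_cmult_right summable_on_add)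
  show "norm (c n - d n) powr p \<le> 2 powr p * (norm (c n) powr p + norm (d n) powr p)" for n
    using norm_diff_powr_le[OF assms(3), of "c n" "d n" 0] by simp
qed auto

lemma lp_add:
  assumes "lp p c" "lp p d" "0 \<le> p"
  shows "lp p (\<lambda>n. c n + d n)"
  using lp_diff[OF assms(1) _ assms(3), of "\<lambda>n. - d n"] assms(2) by (simp add: lp_def)

lemma lp_bounded:
  assumes "lp p c" "0 < p"
  obtains B where "\<And>n. norm (c n) \<le> B"
proof
  fix n
  let ?S = "\<Sum>\<^sub>\<infinity>n. norm (c n) powr p"
  have "sum (\<lambda>n. norm (c n) powr p) {n} \<le> ?S"
    using assms(1) unfolding lp_def by (intro finite_sum_le_infsum) auto
  then have "(norm (c n) powr p) powr (1 / p) \<le> ?S powr (1 / p)"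
    using assms(2) by (intro powr_mono2) auto
  then show "norm (c n) \<le> ?S powr (1 / p)" using assms(2) by (simp add: powr_powr)
qed

text \<open>Since \<open>t\<close> vanishes at negative indices, \<open>c\<close> equals
  \<open>d\<close> there and is computed forwards from index 0. From some \<open>n0\<close> on, the
  coefficients of the recursion are uniformly below one; the finitely many earlier ones only enlarge
  the constant, which is uniform in \<open>d\<close>.\<close>

lemma lp_solve_recursion:
  fixes t :: "int \<Rightarrow> complex" and p :: real
  assumes p: "1 \<le> p" and t_neg: "\<And>n. n < 0 \<Longrightarrow> t n = 0"
    and t_lim: "limsup (\<lambda>n::nat. ereal (norm (t (int n)))) < 1"
  shows "\<exists>K>0. \<forall>d. lp p d \<longrightarrow> (\<exists>c. lp p c \<and> (\<forall>n. c n + t (n - 1) * c (n - 1) = d n) \<and>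
      (\<Sum>\<^sub>\<infinity>n. norm (c n) powr p) \<le> K * (\<Sum>\<^sub>\<infinity>n. norm (d n) powr p))"
proof -
  obtain r where r: "limsup (\<lambda>n::nat. ereal (norm (t (int n)))) < ereal r" "ereal r < 1"
    using ereal_dense2[OF t_lim] by auto
  define \<rho> where "\<rho> = max r 0"
  have \<rho>: "0 \<le> \<rho>" "\<rho> < 1" using r by (auto simp: \<rho>_def)
  obtain n0 where n0: "\<And>k. n0 \<le> k \<Longrightarrow> norm (t (int k)) \<le> \<rho>"
    using Limsup_lessD[OF r(1)] unfolding eventually_sequentially \<rho>_def
    by (metis ereal_less_eq(3) le_max_iff_disj less_ereal.simps(1) less_imp_le)
  \<comment> \<open>A value strictly between \<open>\<rho>\<close> and one, giving
    \<open>add_mult_powr_le\<close> the room it requires.\<close>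
  define s where "s = (\<rho> + 1) / 2"
  have s: "0 < s" "s < 1" "\<rho> < s" using \<rho> by (auto simp: s_def)
  define C where "C = 1 + (\<Sum>k<n0. norm (t (int k)))"
  have C0: "1 \<le> C" unfolding C_def by (simp add: sum_nonneg)
  have C: "norm (t (int k)) \<le> C" for k
  proof (cases "k < n0")
    case True
    then have "norm (t (int k)) \<le> (\<Sum>k<n0. norm (t (int k)))"
      by (intro member_le_sum) auto
    then show ?thesis by (simp add: C_def)
  next
    case False
    then show ?thesis using n0[of k] \<rho> C0 by simp
  qed
  \<comment> \<open>The two summands are the constants at \<open>d\<close> from the crude estimate
    before \<open>n0\<close> and from the sharp one after it; \<open>D\<close> is the crude constant
    at the previous term.\<close>
  define A where "A = 2 powr p + (1 + \<rho> / (s - \<rho>)) powr p"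
  define D where "D = 2 powr p * C powr p"
  have two: "1 \<le> (2::real) powr p" using p by (simp add: ge_one_powr_ge_zero)
  have A: "1 \<le> A" using two by (simp add: A_def add_increasing2)
  have D: "1 \<le> D"
    using mult_mono[OF two, of 1 "C powr p"] C0 p by (simp add: D_def ge_one_powr_ge_zero)
  define K where "K = A / ((1 - s) * (s / D) ^ n0)"
  have K: "0 < K" using A D s by (auto simp: K_def)
  define \<sigma> where "\<sigma> k = (if n0 \<le> k then s else D)" for k
  have main: "\<exists>c. lp p c \<and> (\<forall>n. c n + t (n - 1) * c (n - 1) = d n) \<and>
      (\<Sum>\<^sub>\<infinity>n. norm (c n) powr p) \<le> (1 + K) * (\<Sum>\<^sub>\<infinity>n. norm (d n) powr p)" if d: "lp p d" for d
  proof -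
    define M where "M = rec_nat (d 0) (\<lambda>k x. d (int (Suc k)) - t (int k) * x)"
    have M0: "M 0 = d 0" and MS: "M (Suc k) = d (int (Suc k)) - t (int k) * M k" for k
      by (simp_all add: M_def)
    define c where "c n = (if n < 0 then d n else M (nat n))" for n
    have cM: "c (int k) = M k" for k by (simp add: c_def)
    have rec: "c n + t (n - 1) * c (n - 1) = d n" for n
    proof -
      consider "n < 0" | "n = 0" | k where "n = int (Suc k)"
      proof -
        have "n = int (Suc (nat (n - 1)))" if "0 < n" using that by simp
        then show thesis using that by (meson linorder_neqE)
      qed
      then show ?thesis
      proof cases
        case 1
        then show ?thesis by (simp add: c_def t_neg)
      next
        case 2
        then show ?thesis by (simp add: c_def t_neg M0)
      next
        case (3 k)
        then have "c n = M (Suc k)" "c (n - 1) = M k" "n - 1 = int k"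
          using cM[of "Suc k"] cM[of k] by auto
        then show ?thesis using 3 by (simp add: MS)
      qed
    qed
    have step: "norm (M (Suc k)) powr p
        \<le> A * norm (d (int (Suc k))) powr p + \<sigma> k * norm (M k) powr p" for k
    proof (cases "n0 \<le> k")
      case True
      have "norm (M (Suc k)) \<le> norm (d (int (Suc k))) + norm (t (int k)) * norm (M k)"
        unfolding MS norm_mult[symmetric] by (rule norm_triangle_ineq4)
      also have "\<dots> \<le> norm (d (int (Suc k))) + \<rho> * norm (M k)"
        using n0[OF True] by (intro add_left_mono mult_right_mono) auto
      finally have "norm (M (Suc k)) powr p \<le> (norm (d (int (Suc k))) + \<rho> * norm (M k)) powr p"
        using p by (intro powr_mono2) auto
      also have "\<dots> \<le> (1 + \<rho> / (s - \<rho>)) powr p * norm (d (int (Suc k))) powr p + s * norm (M k) powr p"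
        using p \<rho> s by (intro add_mult_powr_le) auto
      also have "\<dots> \<le> A * norm (d (int (Suc k))) powr p + s * norm (M k) powr p"
        by (intro add_right_mono mult_right_mono) (auto simp: A_def)
      finally show ?thesis using True by (simp add: \<sigma>_def)
    next
      case False
      have "norm (M (Suc k)) powr p
          \<le> 2 powr p * (norm (d (int (Suc k))) powr p + norm (t (int k) * M k) powr p)"
        using norm_diff_powr_le[of p "d (int (Suc k))" "t (int k) * M k" 0] p by (simp add: MS)
      also have "norm (t (int k) * M k) powr p \<le> (C * norm (M k)) powr p"
        using C[of k] p by (intro powr_mono2) (auto simp: norm_mult intro: mult_right_mono)
      also have "\<dots> = C powr p * norm (M k) powr p"
        using C0 by (simp add: powr_mult)
      finally have "norm (M (Suc k)) powr p
          \<le> 2 powr p * norm (d (int (Suc k))) powr p + D * norm (M k) powr p"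
        by (simp add: D_def algebra_simps)
      also have "\<dots> \<le> A * norm (d (int (Suc k))) powr p + D * norm (M k) powr p"
        by (intro add_right_mono mult_right_mono) (auto simp: A_def)
      finally show ?thesis using False by (simp add: \<sigma>_def)
    qed
    have sle: "s \<le> D" using s D by simp
    have part: "(\<Sum>k\<le>N. norm (M k) powr p) \<le> K * (\<Sum>k\<le>N. norm (d (int k)) powr p)" for N
      unfolding K_def
    proof (rule sum_recursive_le[of s D A n0 \<sigma>])
      show "norm (M 0) powr p \<le> A * norm (d (int 0)) powr p"
        using A by (simp add: M0 mult_le_cancel_right1)
    qed (use s A D sle step in \<open>auto simp: \<sigma>_def\<close>)
    have d_nat: "summable (\<lambda>k. norm (d (int k)) powr p)"
      and d_neg: "summable (\<lambda>k. norm (d (- int (Suc k))) powr p)"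
      using d summable_on_int_iff[of "\<lambda>n. norm (d n) powr p"] by (auto simp: lp_def)
    let ?Sd = "\<Sum>k. norm (d (int k)) powr p"
    have bound: "(\<Sum>k\<le>N. norm (M k) powr p) \<le> K * ?Sd" for N
    proof -
      have "(\<Sum>k\<le>N. norm (d (int k)) powr p) \<le> ?Sd"
        using d_nat by (intro sum_le_suminf) auto
      then have "K * (\<Sum>k\<le>N. norm (d (int k)) powr p) \<le> K * ?Sd"
        using K by (intro mult_left_mono) auto
      with part[of N] show ?thesis by linarith
    qed
    have M_sum: "summable (\<lambda>k. norm (M k) powr p)"
      by (rule bounded_imp_summable[OF _ bound]) simp
    have M_le: "(\<Sum>k. norm (M k) powr p) \<le> K * ?Sd"
    proof (rule suminf_le_const[OF M_sum])
      show "(\<Sum>k<n. norm (M k) powr p) \<le> K * ?Sd" for n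
        using bound[of n] sum_mono2[of "{..n}" "{..<n}" "\<lambda>k. norm (M k) powr p"] by force
    qed
    have c_neg: "c (- int (Suc k)) = d (- int (Suc k))" for k by (simp add: c_def)
    have lp_c: "lp p c"
      unfolding lp_def
      by (subst summable_on_int_iff) (use M_sum d_neg in \<open>simp_all only: cM c_neg, auto\<close>)
    have nat_inf: "(\<Sum>\<^sub>\<infinity>k. f k) = (\<Sum>k. f k)" if "\<And>k. 0 \<le> f k" "summable f" for f :: "nat \<Rightarrow> real"
      using that by (intro infsumI norm_summable_imp_has_sum) (auto simp: summable_sums)
    let ?D = "infsum (\<lambda>n. norm (d n) powr p) {..<0}"
    have D0: "0 \<le> ?D" by (intro infsum_nonneg) auto
    have Sd0: "0 \<le> ?Sd" using d_nat by (intro suminf_nonneg) auto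
    have "(\<Sum>\<^sub>\<infinity>n. norm (c n) powr p)
        = infsum (\<lambda>n. norm (c n) powr p) {..<0} + (\<Sum>\<^sub>\<infinity>k. norm (c (int k)) powr p)"
      using lp_c unfolding lp_def by (rule infsum_int_split)
    also have "(\<Sum>\<^sub>\<infinity>k. norm (c (int k)) powr p) = (\<Sum>k. norm (M k) powr p)"
      unfolding cM using M_sum by (intro nat_inf) auto
    also have "infsum (\<lambda>n. norm (c n) powr p) {..<0} = ?D"
      by (intro infsum_cong) (auto simp: c_def)
    finally have "(\<Sum>\<^sub>\<infinity>n. norm (c n) powr p) \<le> ?D + K * ?Sd" using M_le by simp
    also have "\<dots> \<le> (1 + K) * (?D + ?Sd)"
      using K D0 Sd0 by (simp add: algebra_simps)
    also have "?D + ?Sd = (\<Sum>\<^sub>\<infinity>n. norm (d n) powr p)"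
      using infsum_int_split[OF d[unfolded lp_def]] nat_inf[OF _ d_nat] by simp
    finally show ?thesis using lp_c rec by blast
  qed
  show ?thesis using K main by (intro exI[of _ "1 + K"]) auto
qed

section \<open>Uniqueness of Laurent coefficients\<close>

lemma has_sum_finite_sum:
  fixes f :: "'b \<Rightarrow> 'a \<Rightarrow> 'c :: topological_comm_monoid_add"
  assumes "finite A" "\<And>k. k \<in> A \<Longrightarrow> (f k has_sum s k) U"
  shows "((\<lambda>x. \<Sum>k\<in>A. f k x) has_sum (\<Sum>k\<in>A. s k)) U"
  using assms by (induction A rule: finite_induct) (auto intro!: has_sum_add)

lemma sum_roots_of_unity_cis:
  fixes N :: nat and j :: int
  assumes "0 < N"
  shows "(\<Sum>k<N. cis (2 * pi * of_int j * of_nat k / of_nat N)) = (if int N dvd j then of_nat N else 0)"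
proof -
  define \<zeta> where "\<zeta> = cis (2 * pi * of_int j / of_nat N)"
  have pw: "\<zeta> ^ k = cis (2 * pi * of_int j * of_nat k / of_nat N)" for k
    unfolding \<zeta>_def Complex.DeMoivre by (rule arg_cong[where f=cis]) simp
  have \<zeta>N: "\<zeta> ^ N = 1"
    unfolding pw using assms cis_multiple_2pi[of "of_int j"] by simp
  show ?thesis
  proof (cases "int N dvd j")
    case True
    then obtain i where i: "j = int N * i" by (elim dvdE)
    then have "\<zeta> = 1"
      using assms cis_multiple_2pi[of "of_int i"] by (simp add: \<zeta>_def mult.assoc)
    then show ?thesis using True by (simp add: pw[symmetric])
  next
    case False
    have "\<zeta> \<noteq> 1"
    proof
      assume "\<zeta> = 1"
      then obtain i :: int where "2 * pi * of_int j / of_nat N = of_int i * (2 * pi)"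
        unfolding \<zeta>_def cis_eq_1_iff by blast
      then have "real_of_int j = real_of_int (i * int N)"
        using assms by (simp add: field_simps)
      then have "j = i * int N" by linarith
      then show False using False by simp
    qed
    then have "(\<Sum>k<N. \<zeta> ^ k) = 0"
      using geometric_sum[of \<zeta> N] \<zeta>N by simp
    then show ?thesis using False by (simp add: pw)
  qed
qed

text \<open>Averaging over the \<open>N\<close>-th roots of unity on the circle kills all coefficients whose
  index is not congruent to \<open>m\<close>; letting \<open>N\<close> grow isolates the coefficient of index \<open>m\<close>.\<close>

lemma laurent_series_zero_unique:
  fixes c :: "int \<Rightarrow> complex" and \<rho> :: real
  assumes \<rho>: "0 < \<rho>" and zero: "\<And>z. norm z = \<rho> \<Longrightarrow> ((\<lambda>n. c n * z powi n) has_sum 0) UNIV"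
  shows "c m = 0"
proof -
  define d where "d n = c n * of_real \<rho> powi n" for n
  have d_cis: "((\<lambda>n. d n * cis (of_int n * \<theta>)) has_sum 0) UNIV" for \<theta>
  proof -
    have "((\<lambda>n. c n * (of_real \<rho> * cis \<theta>) powi n) has_sum 0) UNIV"
      using \<rho> by (intro zero) (simp add: norm_mult)
    then show ?thesis
      by (simp add: d_def power_int_mult_distrib cis_power_int mult_ac)
  qed
  have "d summable_on UNIV"
    using d_cis[of 0] by (simp add: has_sum_imp_summable)
  then have d_abs: "(\<lambda>n. norm (d n)) summable_on UNIV"
    by (simp add: summable_on_iff_abs_summable_on_complex)
  have small: "norm (d m) < e" if e: "0 < e" for e
  proof -
    obtain K :: nat where K: "\<And>f. \<forall>n. 0 \<le> f n \<and> f n \<le> norm (d n) \<and> (\<bar>n\<bar> < int K \<longrightarrow> f n = 0)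
        \<Longrightarrow> infsum f UNIV < e"
      using infsum_small_tail[OF d_abs _ e] by auto
    \<comment> \<open>Any index other than \<open>m\<close> that is congruent to \<open>m\<close>
      modulo \<open>N\<close> then lies outside the window of radius \<open>K\<close>.\<close>
    define N where "N = K + nat \<bar>m\<bar> + 1"
    have N: "0 < N" by (simp add: N_def)
    define g where "g n = (if int N dvd n - m then d n else 0)" for n
    have "((\<lambda>n. \<Sum>k<N. cis (- (2 * pi * of_int m * of_nat k / of_nat N))
        * (d n * cis (of_int n * (2 * pi * of_nat k / of_nat N)))) has_sum
        (\<Sum>k<N. cis (- (2 * pi * of_int m * of_nat k / of_nat N)) * 0)) UNIV"
      by (intro has_sum_finite_sum has_sum_cmult_right d_cis) auto
    moreover have "(\<Sum>k<N. cis (- (2 * pi * of_int m * of_nat k / of_nat N))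
        * (d n * cis (of_int n * (2 * pi * of_nat k / of_nat N)))) = of_nat N * g n" for n
    proof -
      have "(\<Sum>k<N. cis (- (2 * pi * of_int m * of_nat k / of_nat N))
          * (d n * cis (of_int n * (2 * pi * of_nat k / of_nat N))))
        = d n * (\<Sum>k<N. cis (2 * pi * of_int (n - m) * of_nat k / of_nat N))"
        unfolding sum_distrib_left
      proof (rule sum.cong[OF refl])
        fix k
        have "cis (- (2 * pi * of_int m * of_nat k / of_nat N)) * cis (of_int n * (2 * pi * of_nat k / of_nat N))
            = cis (2 * pi * of_int (n - m) * of_nat k / of_nat N)"
          unfolding cis_mult by (rule arg_cong[where f=cis]) (use N in \<open>simp add: field_simps\<close>)
        then show "cis (- (2 * pi * of_int m * of_nat k / of_nat N))
            * (d n * cis (of_int n * (2 * pi * of_nat k / of_nat N)))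
          = d n * cis (2 * pi * of_int (n - m) * of_nat k / of_nat N)"
          by (metis mult.assoc mult.commute)
      qed
      then show ?thesis unfolding sum_roots_of_unity_cis[OF N] by (simp add: g_def)
    qed
    ultimately have "((\<lambda>n. of_nat N * g n) has_sum 0) UNIV" by simp
    then have g0: "(g has_sum 0) UNIV"
      using N by (subst (asm) has_sum_cmult_right_iff) auto
    \<comment> \<open>Without the index \<open>m\<close> the averaged series has sum
      \<open>- d m\<close>, and all its terms belong to the tail of \<open>d\<close>.\<close>
    define h where "h n = (if n = m then 0 else g n)" for n
    have "((\<lambda>n. if n = m then - d m else 0) has_sum (- d m)) UNIV"
      by (rule has_sum_finite_neutralI[of "{m}"]) auto
    from has_sum_add[OF g0 this]
    have "((\<lambda>n. g n + (if n = m then - d m else 0)) has_sum (- d m)) UNIV" by simp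
    also have "(\<lambda>n. g n + (if n = m then - d m else 0)) = h"
      by (auto simp: h_def g_def)
    finally have h: "(h has_sum (- d m)) UNIV" .
    have "norm (- d m) \<le> infsum (\<lambda>n. norm (h n)) UNIV"
    proof (rule norm_has_sum_bound)
      have "(\<lambda>n. norm (h n)) summable_on UNIV"
        using h has_sum_imp_summable summable_on_iff_abs_summable_on_complex by blast
      then show "((\<lambda>n. norm (h n)) has_sum infsum (\<lambda>n. norm (h n)) UNIV) UNIV" by simp
    qed (rule h)
    also have "\<dots> < e"
    proof (rule K, intro allI conjI impI)
      fix n
      show "0 \<le> norm (h n)" "norm (h n) \<le> norm (d n)" by (auto simp: h_def g_def)
      assume n: "\<bar>n\<bar> < int K"
      have "\<not> int N dvd n - m" if "n \<noteq> m"
      proof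
        assume "int N dvd n - m"
        then have "int N \<le> \<bar>n - m\<bar>" using that dvd_imp_le_int[of "n - m" "int N"] by simp
        then show False using n by (simp add: N_def)
      qed
      then show "norm (h n) = 0" by (simp add: h_def g_def)
    qed
    finally show ?thesis by simp
  qed
  have "norm (d m) = 0"
    using small[of "norm (d m)"] by (metis less_irrefl norm_ge_zero order_le_less)
  then show ?thesis using \<rho> by (simp add: d_def)
qed


section \<open>The space on the annulus\<close>

text \<open>The root test in \<open>powr\<close> form: a number strictly between the limsup and
  \<open>1 / x\<close> gives a geometric majorant.\<close>

lemma summable_root_bound:
  fixes u :: "nat \<Rightarrow> real"
  assumes u: "\<And>n. 0 \<le> u n" and lim: "limsup (\<lambda>n. ereal (u n powr (1 / real n))) < ereal (1 / x)"
    and x: "0 < x"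
  shows "summable (\<lambda>n. u n * x ^ n)"
proof -
  obtain \<rho> where \<rho>: "limsup (\<lambda>n. ereal (u n powr (1 / real n))) < ereal \<rho>" "\<rho> < 1 / x"
    using ereal_dense2[OF lim] by auto
  have "0 \<le> limsup (\<lambda>n. ereal (u n powr (1 / real n)))" by (rule le_Limsup) auto
  then have "0 < ereal \<rho>" using \<rho>(1) by (rule order.strict_trans1)
  then have \<rho>0: "0 < \<rho>" by simp
  have "\<forall>\<^sub>F n in sequentially. norm (u n * x ^ n) \<le> (\<rho> * x) ^ n"
    \<comment> \<open>At \<open>n = 0\<close> the exponent \<open>1 / real n\<close> is 0 by
      convention, so the root bound is used for positive \<open>n\<close> only.\<close>
    using Limsup_lessD[OF \<rho>(1)] eventually_gt_at_top[of 0]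
  proof eventually_elim
    case (elim n)
    then have "u n powr (1 / real n) \<le> \<rho>" by simp
    then have "(u n powr (1 / real n)) powr real n \<le> \<rho> powr real n"
      by (intro powr_mono2) auto
    then have "u n \<le> \<rho> ^ n"
      using elim u[of n] \<rho>0 by (simp add: powr_powr powr_realpow)
    then show ?case using u[of n] x by (simp add: power_mult_distrib mult_right_mono)
  qed
  moreover have "summable (\<lambda>n. (\<rho> * x) ^ n)"
    using \<rho> \<rho>0 x by (intro summable_geometric) (simp add: field_simps)
  ultimately show ?thesis by (rule summable_comparison_test_ev)
qed

locale annular_lp =
  fixes p :: real and a b :: "int \<Rightarrow> complex"
  assumes p: "1 < p" and a_nz: "a n \<noteq> 0" and b_neg: "n < 0 \<Longrightarrow> b n = 0"
    and rR: "r_ann a < R_ann a b"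
    and b_lim: "limsup (\<lambda>n::nat. ereal (norm (b (int n) / a (int n + 1)))) < 1"
begin

abbreviation \<Omega> where "\<Omega> \<equiv> Omega a b"

lemma r_ann_nonneg: "0 \<le> r_ann a"
  unfolding r_ann_def by (rule le_Limsup) auto

lemma invR_ann_nonneg: "0 \<le> invR_ann a b"
  unfolding invR_ann_def by (rule le_Limsup) auto

lemma Omega_nz: "z \<in> \<Omega> \<Longrightarrow> z \<noteq> 0"
  using r_ann_nonneg by (auto simp: Omega_def zero_ereal_def[symmetric])

lemma ex_circle_Omega: "\<exists>\<rho>>0. \<forall>z. norm z = \<rho> \<longrightarrow> z \<in> \<Omega>"
proof -
  obtain \<rho> where \<rho>: "r_ann a < ereal \<rho>" "ereal \<rho> < R_ann a b"
    using ereal_dense2[OF rR] by auto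
  have "0 < ereal \<rho>" using r_ann_nonneg \<rho>(1) by (rule order.strict_trans1)
  then show ?thesis using \<rho> by (intro exI[of _ \<rho>]) (auto simp: Omega_def)
qed

text \<open>The inner radius controls the negative powers. The outer radius controls
  \<open>a\<close> and \<open>b\<close> together on the nonnegative ones, and the extra power of
  \<open>z\<close> at \<open>b\<close> costs one factor \<open>norm z\<close>.\<close>

lemma summable_Omega:
  assumes z: "z \<in> \<Omega>"
  shows "(\<lambda>n. norm (a n * z powi n)) summable_on UNIV" (is ?A)
    and "(\<lambda>n. norm (b n * z powi (n + 1))) summable_on UNIV" (is ?B)
proof -
  define x where "x = norm z"
  have x: "0 < x" using Omega_nz[OF z] by (simp add: x_def)
  have zx: "r_ann a < ereal x" "ereal x < inverse (invR_ann a b)"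
    using z by (auto simp: Omega_def R_ann_def x_def)
  have "invR_ann a b < ereal (1 / x)"
  \<comment> \<open>The value 0 is separated from the other real ones because its inverse in
    \<open>ereal\<close> is infinite.\<close>
  proof (cases "invR_ann a b")
    case (real y)
    then show ?thesis using zx(2) x invR_ann_nonneg
      by (cases "y = 0") (auto simp: field_simps)
  qed (use zx(2) x invR_ann_nonneg in auto)
  then have ab: "summable (\<lambda>n. (norm (a (int n)) + norm (b (int n))) * x ^ n)"
    unfolding invR_ann_def by (intro summable_root_bound x) auto
  have "limsup (\<lambda>n. ereal (norm (a (- int n)) powr (1 / real n))) < ereal (1 / (1 / x))"
    using zx(1) x by (simp add: r_ann_def)
  then have "summable (\<lambda>n. norm (a (- int n)) * (1 / x) ^ n)"
    by (intro summable_root_bound) (use x in auto)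
  then have neg: "summable (\<lambda>n. norm (a (- int (Suc n))) * (1 / x) ^ Suc n)"
    by (subst summable_Suc_iff)
  have nrm: "norm (z powi n) = x powi n" for n
    by (simp add: x_def norm_power_int)
  have "summable (\<lambda>n. norm (a (int n) * z powi int n))"
    by (rule summable_comparison_test'[OF ab, of 0]) (use x in \<open>simp add: norm_mult nrm norm_power x_def mult_right_mono\<close>)
  moreover have "summable (\<lambda>n. norm (a (- int (Suc n)) * z powi (- int (Suc n))))"
  proof -
    have "norm (a (- int (Suc n)) * z powi (- int (Suc n))) = norm (a (- int (Suc n))) * (1 / x) ^ Suc n" for n
    proof -
      have "x powi (- int (Suc n)) = (1 / x) ^ Suc n"
        by (simp only: power_int_minus power_int_of_nat power_one_over inverse_eq_divide)
      then show ?thesis by (simp only: norm_mult nrm)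
    qed
    then show ?thesis using neg by (simp only:)
  qed
  ultimately show ?A by (subst summable_on_int_iff) auto
  have "summable (\<lambda>n. norm (b (int n) * z powi (int n + 1)))"
  proof (rule summable_comparison_test'[OF summable_mult[OF ab, of x], of 0])
    fix n :: nat
    have "norm (b (int n) * z powi (int n + 1)) = norm (b (int n)) * (x * x ^ n)"
      using x by (simp add: norm_mult nrm power_int_add_1' x_def norm_power)
    also have "\<dots> \<le> x * ((norm (a (int n)) + norm (b (int n))) * x ^ n)"
      using x by (simp add: algebra_simps)
    finally show "norm (norm (b (int n) * z powi (int n + 1))) \<le> x * ((norm (a (int n)) + norm (b (int n))) * x ^ n)"
      by simp
  qed
  moreover have "summable (\<lambda>n. norm (b (- int (Suc n)) * z powi (- int (Suc n) + 1)))"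
    using b_neg by simp
  ultimately show ?B by (subst summable_on_int_iff) auto
qed

lemma summable_lp_Omega:
  assumes z: "z \<in> \<Omega>" and c: "lp p c"
  shows "(\<lambda>n. a n * c n * z powi n) summable_on UNIV" (is ?A)
    and "(\<lambda>n. b n * c n * z powi (n + 1)) summable_on UNIV" (is ?B)
proof -
  obtain B where B: "\<And>n. norm (c n) \<le> B" using lp_bounded[OF c] p by auto
  have "(\<lambda>n. norm (a n * c n * z powi n)) summable_on UNIV"
  proof (rule summable_on_comparison_test)
    show "(\<lambda>n. B * norm (a n * z powi n)) summable_on UNIV"
      using summable_Omega(1)[OF z] by (rule summable_on_cmult_right)
    show "norm (a n * c n * z powi n) \<le> B * norm (a n * z powi n)" for n
      using mult_right_mono[OF B[of n], of "norm (a n * z powi n)"] by (simp add: norm_mult mult_ac)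
  qed auto
  then show ?A by (rule abs_summable_summable)
  have "(\<lambda>n. norm (b n * c n * z powi (n + 1))) summable_on UNIV"
  proof (rule summable_on_comparison_test)
    show "(\<lambda>n. B * norm (b n * z powi (n + 1))) summable_on UNIV"
      using summable_Omega(2)[OF z] by (rule summable_on_cmult_right)
    show "norm (b n * c n * z powi (n + 1)) \<le> B * norm (b n * z powi (n + 1))" for n
      using mult_right_mono[OF B[of n], of "norm (b n * z powi (n + 1))"] by (simp add: norm_mult mult_ac)
  qed auto
  then show ?B by (rule abs_summable_summable)
qed

text \<open>The element with coordinates \<open>y\<close> of the space belonging to \<open>b = 0\<close>.\<close>

definition laurent :: "(int \<Rightarrow> complex) \<Rightarrow> complex \<Rightarrow> complex" where
  "laurent y = (\<lambda>z. if z \<in> \<Omega> then (\<Sum>\<^sub>\<infinity>n. a n * y n * z powi n) else 0)"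

text \<open>The change of coordinates from the basis \<open>f\<^sub>n\<close> to the basis \<open>a\<^sub>n z\<^sup>n\<close>.\<close>

definition J :: "(int \<Rightarrow> complex) \<Rightarrow> int \<Rightarrow> complex" where
  "J c n = c n + b (n - 1) / a n * c (n - 1)"

lemma laurent_has_sum:
  assumes "lp p y" "z \<in> \<Omega>"
  shows "((\<lambda>n. a n * y n * z powi n) has_sum laurent y z) UNIV"
  using summable_lp_Omega(1)[OF assms(2,1)] assms(2) by (simp add: laurent_def)

lemma ratio_bounded: "\<exists>B\<ge>0. \<forall>n. norm (b (n - 1) / a n) \<le> B"
proof -
  have "\<forall>\<^sub>F k in sequentially. norm (b (int k) / a (int k + 1)) \<le> 1"
    using Limsup_lessD[OF b_lim] by eventually_elim (simp add: one_ereal_def)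
  then obtain n0 where n0: "\<And>k::nat. n0 \<le> k \<Longrightarrow> norm (b (int k) / a (int k + 1)) \<le> 1"
    unfolding eventually_sequentially by blast
  define B where "B = 1 + (\<Sum>k<n0. norm (b (int k) / a (int k + 1)))"
  have B: "1 \<le> B" unfolding B_def by (simp add: sum_nonneg)
  have "norm (b (n - 1) / a n) \<le> B" for n
  proof (cases "n - 1 < 0")
    case True
    then show ?thesis using B b_neg[of "n - 1"] by simp
  next
    case False
    then obtain k where k: "n - 1 = int k" by (metis nonneg_int_cases not_less)
    then have n: "n = int k + 1" by simp
    show ?thesis
    proof (cases "k < n0")
      case True
      then have "norm (b (int k) / a (int k + 1)) \<le> (\<Sum>k<n0. norm (b (int k) / a (int k + 1)))"
        by (intro member_le_sum) auto
      then show ?thesis by (simp add: n B_def)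
    next
      case False
      then show ?thesis using n0[of k] B by (simp add: n)
    qed
  qed
  then show ?thesis using B by (intro exI[of _ B]) auto
qed

lemma lp_J:
  assumes "lp p c"
  shows "lp p (J c)"
proof -
  obtain B where B: "0 \<le> B" "\<And>n. norm (b (n - 1) / a n) \<le> B"
    using ratio_bounded by blast
  have s: "lp p (\<lambda>n. c (n - 1))" using lp_shift[OF assms, of "- 1"] by simp
  have "lp p (\<lambda>n. b (n - 1) / a n * c (n - 1))"
  proof (rule lp_mono[OF s])
    show "norm (b (n - 1) / a n * c (n - 1)) \<le> B * norm (c (n - 1))" for n
      unfolding norm_mult by (intro mult_right_mono B) auto
  qed (use p B in auto)
  then show ?thesis unfolding J_def[abs_def] using assms p by (intro lp_add) auto
qed

text \<open>The summand \<open>b n\<close> of the n-th basis function belongs to the power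
  \<open>n + 1\<close>. Absolute convergence allows splitting the sum and shifting the index of that
  part.\<close>

lemma Phi_eq_laurent:
  assumes c: "lp p c"
  shows "Phi a b c = laurent (J c)"
proof
  fix z
  show "Phi a b c z = laurent (J c) z"
  proof (cases "z \<in> \<Omega>")
    case True
    note nz = Omega_nz[OF True]
    have bij: "bij (\<lambda>n::int. n - 1)" using bij_plus_right[of "- 1 :: int"] by simp
    let ?u = "\<lambda>n. a n * c n * z powi n" and ?v = "\<lambda>n. b n * c n * z powi (n + 1)"
    note s = summable_lp_Omega[OF True c]
    have "c n * fb a b n z = ?u n + ?v n" for n
      using nz b_neg[of n] power_int_add_1[of z n]
      by (cases "0 \<le> n") (simp_all add: fb_def distrib_right distrib_left mult_ac)
    then have "(\<Sum>\<^sub>\<infinity>n. c n * fb a b n z) = infsum ?u UNIV + infsum ?v UNIV"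
      using s by (simp add: infsum_add)
    also have "infsum ?v UNIV = (\<Sum>\<^sub>\<infinity>n. ?v (n - 1))"
      using infsum_reindex_bij_betw[of "\<lambda>n. n - 1" UNIV UNIV ?v]
      by (simp add: bij)
    also have "infsum ?u UNIV + (\<Sum>\<^sub>\<infinity>n. ?v (n - 1)) = (\<Sum>\<^sub>\<infinity>n. ?u n + ?v (n - 1))"
    proof (rule infsum_add[symmetric])
      show "(\<lambda>n. ?v (n - 1)) summable_on UNIV"
        using s(2) summable_on_reindex_bij_betw[of "\<lambda>n. n - 1" UNIV UNIV ?v]
        by (simp add: bij)
    qed (rule s)
    also have "(\<lambda>n. ?u n + ?v (n - 1)) = (\<lambda>n. a n * J c n * z powi n)"
      using a_nz by (auto simp: J_def field_simps)
    finally show ?thesis using True by (simp add: Phi_def laurent_def)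
  qed (simp add: Phi_def laurent_def)
qed

text \<open>Shows that the description by \<open>THE\<close> denotes something: the expansion exists
  on the whole annulus, and a single circle inside it already determines the coefficients.\<close>

lemma laurent_coeff_laurent:
  assumes y: "lp p y"
  shows "laurent_coeff \<Omega> (laurent y) = (\<lambda>n. a n * y n)"
  unfolding laurent_coeff_def
proof (rule the_equality)
  show "\<forall>z\<in>\<Omega>. ((\<lambda>n. a n * y n * z powi n) has_sum laurent y z) UNIV"
    using laurent_has_sum[OF y] by blast
next
  fix c assume c: "\<forall>z\<in>\<Omega>. ((\<lambda>n. c n * z powi n) has_sum laurent y z) UNIV"
  obtain \<rho> where \<rho>: "0 < \<rho>" "\<And>z. norm z = \<rho> \<Longrightarrow> z \<in> \<Omega>"
    using ex_circle_Omega by blast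
  have "c n - a n * y n = 0" for n
  proof (rule laurent_series_zero_unique[OF \<rho>(1)])
    fix z :: complex assume "norm z = \<rho>"
    then have z: "z \<in> \<Omega>" by (rule \<rho>(2))
    have "((\<lambda>n. - (a n * y n * z powi n)) has_sum (- laurent y z)) UNIV"
      using laurent_has_sum[OF y z] by (simp add: has_sum_uminus)
    from has_sum_add[OF c[rule_format, OF z] this]
    show "((\<lambda>n. (c n - a n * y n) * z powi n) has_sum 0) UNIV"
      by (simp add: algebra_simps)
  qed
  then show "c = (\<lambda>n. a n * y n)" by auto
qed

lemma laurent_inj:
  assumes "lp p y" "lp p y'" "laurent y = laurent y'"
  shows "y = y'"
proof
  fix n
  have "a n * y n = a n * y' n"
    using laurent_coeff_laurent[OF assms(1)] laurent_coeff_laurent[OF assms(2)] assms(3)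
    by (metis (no_types))
  then show "y n = y' n" using a_nz by simp
qed

lemma J_inj:
  assumes "J c = J c'"
  shows "c = c'"
proof
  fix n
  have eq: "c n + b (n - 1) / a n * c (n - 1) = c' n + b (n - 1) / a n * c' (n - 1)" for n
    using fun_cong[OF assms, of n] by (simp add: J_def)
  \<comment> \<open>The induction starts at index -1, where the equation involves only the entry
    itself because \<open>b\<close> vanishes at -2.\<close>
  have nat: "c (int k - 1) = c' (int k - 1)" for k
  proof (induction k)
    case 0
    then show ?case using eq[of "- 1"] b_neg[of "- 2"] by simp
  next
    case (Suc k)
    then show ?case using eq[of "int k"] by simp
  qed
  show "c n = c' n"
  proof (cases "n < 0")
    case True
    then show ?thesis using eq[of n] b_neg[of "n - 1"] by simp
  next
    case False
    then show ?thesis using nat[of "nat (n + 1)"] by simp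
  qed
qed

lemma ex_J_inverse_bound:
  "\<exists>K>0. \<forall>y. lp p y \<longrightarrow> (\<exists>c. lp p c \<and> J c = y \<and>
      (\<Sum>\<^sub>\<infinity>n. norm (c n) powr p) \<le> K * (\<Sum>\<^sub>\<infinity>n. norm (y n) powr p))"
proof -
  define t where "t n = b n / a (n + 1)" for n
  have "(\<forall>n. c n + t (n - 1) * c (n - 1) = d n) \<longleftrightarrow> J c = d" for c d
    by (auto simp: J_def t_def fun_eq_iff)
  moreover have "\<exists>K>0. \<forall>d. lp p d \<longrightarrow> (\<exists>c. lp p c \<and> (\<forall>n. c n + t (n - 1) * c (n - 1) = d n) \<and>
      (\<Sum>\<^sub>\<infinity>n. norm (c n) powr p) \<le> K * (\<Sum>\<^sub>\<infinity>n. norm (d n) powr p))"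
  proof (rule lp_solve_recursion)
    show "limsup (\<lambda>n. ereal (norm (t (int n)))) < 1" using b_lim by (simp add: t_def)
  qed (use p b_neg in \<open>auto simp: t_def\<close>)
  ultimately show ?thesis by simp
qed

text \<open>The inclusion from right to left is the surjectivity of \<open>J\<close> on p-summable
  sequences.\<close>

lemma Xsp_eq: "Xsp p a b = {laurent y | y. lp p y}"
proof -
  obtain K where K: "\<And>y. lp p y \<Longrightarrow> \<exists>c. lp p c \<and> J c = y \<and>
      (\<Sum>\<^sub>\<infinity>n. norm (c n) powr p) \<le> K * (\<Sum>\<^sub>\<infinity>n. norm (y n) powr p)"
    using ex_J_inverse_bound by blast
  show ?thesis
  proof (intro equalityI subsetI)
    fix f assume "f \<in> Xsp p a b"
    then obtain c where "f = Phi a b c" "lp p c" by (auto simp: Xsp_def)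
    then show "f \<in> {laurent y | y. lp p y}" using Phi_eq_laurent lp_J by auto
  next
    fix f assume "f \<in> {laurent y | y. lp p y}"
    then obtain y where y: "f = laurent y" "lp p y" by blast
    with K obtain c where "lp p c" "J c = y" by blast
    then show "f \<in> Xsp p a b" using y Phi_eq_laurent[of c]
      unfolding Xsp_def by (intro CollectI exI[of _ c]) simp
  qed
qed

lemma coef_laurent_J:
  assumes c: "lp p c"
  shows "coef p a b (laurent (J c)) = c"
  unfolding coef_def
proof (rule the_equality)
  show "lp p c \<and> Phi a b c = laurent (J c)" using c Phi_eq_laurent by simp
next
  fix c' assume c': "lp p c' \<and> Phi a b c' = laurent (J c)"
  then have "laurent (J c') = laurent (J c)" using Phi_eq_laurent[of c'] by simp
  then have "J c' = J c" using laurent_inj lp_J c c' by blast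
  then show "c' = c" by (rule J_inj)
qed

text \<open>The norm is defined through the coordinates before \<open>J\<close>, so this is the
  boundedness of the inverse of \<open>J\<close>. It turns density in Laurent coordinates into
  density for \<open>Xnorm\<close>.\<close>

lemma Xnorm_laurent_le:
  "\<exists>K>0. \<forall>y. lp p y \<longrightarrow> Xnorm p a b (laurent y) \<le> (K * (\<Sum>\<^sub>\<infinity>n. norm (y n) powr p)) powr (1 / p)"
proof -
  obtain K where K: "0 < K" "\<And>y. lp p y \<Longrightarrow> \<exists>c. lp p c \<and> J c = y \<and>
      (\<Sum>\<^sub>\<infinity>n. norm (c n) powr p) \<le> K * (\<Sum>\<^sub>\<infinity>n. norm (y n) powr p)"
    using ex_J_inverse_bound by blast
  have "Xnorm p a b (laurent y) \<le> (K * (\<Sum>\<^sub>\<infinity>n. norm (y n) powr p)) powr (1 / p)" if y: "lp p y" for y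
  proof -
    obtain c where c: "lp p c" "J c = y"
      "(\<Sum>\<^sub>\<infinity>n. norm (c n) powr p) \<le> K * (\<Sum>\<^sub>\<infinity>n. norm (y n) powr p)"
      using K(2)[OF y] by blast
    then have "Xnorm p a b (laurent y) = (\<Sum>\<^sub>\<infinity>n. norm (c n) powr p) powr (1 / p)"
      using coef_laurent_J[OF c(1)] by (simp add: Xnorm_def lp_norm_def)
    also have "\<dots> \<le> (K * (\<Sum>\<^sub>\<infinity>n. norm (y n) powr p)) powr (1 / p)"
      using c(3) p by (intro powr_mono2 infsum_nonneg) auto
    finally show ?thesis .
  qed
  then show ?thesis using K(1) by blast
qed

lemma laurent_diff:
  assumes "lp p y" "lp p y'"
  shows "laurent y - laurent y' = laurent (\<lambda>n. y n - y' n)"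
proof
  fix z
  show "(laurent y - laurent y') z = laurent (\<lambda>n. y n - y' n) z"
  proof (cases "z \<in> \<Omega>")
    case True
    have "((\<lambda>n. - (a n * y' n * z powi n)) has_sum (- laurent y' z)) UNIV"
      using laurent_has_sum[OF assms(2) True] by (simp add: has_sum_uminus)
    from has_sum_add[OF laurent_has_sum[OF assms(1) True] this]
    have "((\<lambda>n. a n * (y n - y' n) * z powi n) has_sum (laurent y z - laurent y' z)) UNIV"
      by (simp add: algebra_simps)
    then show ?thesis using True by (simp add: laurent_def infsumI)
  qed (simp add: laurent_def)
qed

end

section \<open>The weighted shift\<close>

text \<open>Nonzero weights are implicit in condition (iii), whose second series divides by products
  of them; here they also make \<open>u\<close> free of zeros.\<close>

locale annular_shift = annular_lp +
  fixes w :: "int \<Rightarrow> complex"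
  assumes w_nz: "w n \<noteq> 0"
    and w_bdd: "bdd_above (range (\<lambda>n. norm (w (n + 1) * a (n + 1) / a n)))"
begin

text \<open>The operator \<open>Bw\<close> in coordinates with respect to the functions
  \<open>a n * z powi n\<close>.\<close>

definition T :: "(int \<Rightarrow> complex) \<Rightarrow> int \<Rightarrow> complex" where
  "T y n = w (n + 1) * a (n + 1) / a n * y (n + 1)"

lemma ex_T_bound: "\<exists>C\<ge>0. \<forall>n. norm (w (n + 1) * a (n + 1) / a n) \<le> C"
proof -
  obtain C where C: "\<And>n. norm (w (n + 1) * a (n + 1) / a n) \<le> C"
    using w_bdd unfolding bdd_above_def by blast
  then show ?thesis by (intro exI[of _ C]) (use norm_ge_zero order_trans in blast)
qed

lemma lp_T:
  assumes "lp p y"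
  shows "lp p (T y)"
proof -
  obtain C where C: "0 \<le> C" "\<And>n. norm (w (n + 1) * a (n + 1) / a n) \<le> C"
    using ex_T_bound by blast
  show ?thesis
  proof (rule lp_mono[OF lp_shift[OF assms, of 1]])
    show "norm (T y n) \<le> C * norm (y (n + 1))" for n
      unfolding T_def norm_mult[of _ "y (n + 1)"] by (intro mult_right_mono C) auto
  qed (use p C in auto)
qed

lemma Bw_laurent:
  assumes y: "lp p y"
  shows "Bw w \<Omega> (laurent y) = laurent (T y)"
proof
  fix z
  let ?f = "\<lambda>n. w n * (a n * y n) * z powi (n - 1)"
  have "infsum ?f UNIV = (\<Sum>\<^sub>\<infinity>n. ?f (n + 1))"
    using infsum_reindex_bij_betw[of "\<lambda>n. n + 1" UNIV UNIV ?f] by (simp add: bij_plus_right)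
  also have "(\<lambda>n. ?f (n + 1)) = (\<lambda>n. a n * T y n * z powi n)"
    using a_nz by (auto simp: T_def)
  finally show "Bw w \<Omega> (laurent y) z = laurent (T y) z"
    unfolding Bw_def laurent_coeff_laurent[OF y] by (simp add: laurent_def)
qed

lemma Bw_funpow_laurent:
  assumes "lp p y"
  shows "lp p ((T ^^ k) y) \<and> (Bw w \<Omega> ^^ k) (laurent y) = laurent ((T ^^ k) y)"
  using assms by (induction k) (auto simp: lp_T Bw_laurent)

text \<open>The fixed sequence of the shift on Laurent coefficients; dividing by it turns the weighted
  shift into the unweighted one.\<close>

definition u :: "int \<Rightarrow> complex" where
  "u n = (if 0 \<le> n then 1 / (\<Prod>j\<in>{1..n}. w j) else (\<Prod>j\<in>{n + 1..0}. w j))"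

lemma u_nz: "u n \<noteq> 0"
  using w_nz by (auto simp: u_def)

lemma u_rec: "u n = w (n + 1) * u (n + 1)"
proof (cases "0 \<le> n")
  case True
  then have "{1..n + 1} = insert (n + 1) {1..n}" by auto
  then show ?thesis using True w_nz by (simp add: u_def)
next
  case False
  then have "{n + 1..0} = insert (n + 1) {n + 2..0}" by auto
  then have "u n = w (n + 1) * (\<Prod>j\<in>{n + 2..0}. w j)" using False by (simp add: u_def)
  moreover have "u (n + 1) = (\<Prod>j\<in>{n + 2..0}. w j)"
    using False by (cases "n = - 1") (auto simp: u_def add.assoc)
  ultimately show ?thesis by simp
qed

text \<open>Here \<open>s\<close> is the sequence of Laurent coefficients divided by
  \<open>u\<close>.\<close>

definition scale :: "(int \<Rightarrow> complex) \<Rightarrow> int \<Rightarrow> complex" where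
  "scale s n = u n / a n * s n"

definition m :: "int \<Rightarrow> real" where
  "m n = norm (u n / a n) powr p"

lemma m_pos: "0 < m n"
  using u_nz a_nz by (simp add: m_def)

lemma norm_scale_powr: "norm (scale s n) powr p = norm (s n) powr p * m n"
  unfolding scale_def m_def norm_mult by (simp add: powr_mult mult.commute)

lemma T_scale: "T (scale s) = scale (\<lambda>n. s (n + 1))"
proof
  fix n
  have "T (scale s) n = (w (n + 1) * u (n + 1)) / a n * s (n + 1)"
    using a_nz[of "n + 1"] by (simp add: T_def scale_def)
  then show "T (scale s) n = scale (\<lambda>n. s (n + 1)) n"
    unfolding u_rec[symmetric] by (simp add: scale_def)
qed

lemma T_funpow_scale: "(T ^^ k) (scale s) = scale (\<lambda>n. s (n + int k))"
proof (induction k arbitrary: s)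
  case (Suc k)
  then show ?case by (simp add: T_scale funpow_Suc_right algebra_simps del: funpow.simps)
qed simp

lemma ex_scale: "\<exists>s. y = scale s"
  using u_nz a_nz by (intro exI[of _ "\<lambda>n. y n * a n / u n"]) (auto simp: scale_def)

lemma scale_inj: "scale s = scale s' \<Longrightarrow> s = s'"
  using u_nz a_nz by (auto simp: scale_def fun_eq_iff)

text \<open>The two series of (iii) are the values of \<open>m\<close> at negative and at positive
  indices; the single term \<open>m 0\<close> is discarded.\<close>

lemma m_summable_iff:
  "m summable_on UNIV \<longleftrightarrow>
    summable (\<lambda>n::nat. norm ((\<Prod>j\<in>{1 - int (Suc n)..0}. w j) / a (- int (Suc n))) powr p)
    \<and> summable (\<lambda>n::nat. norm (1 / ((\<Prod>j\<in>{1..int (Suc n)}. w j) * a (int (Suc n)))) powr p)"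
proof -
  have neg: "m (- int (Suc n)) = norm ((\<Prod>j\<in>{1 - int (Suc n)..0}. w j) / a (- int (Suc n))) powr p" for n
    by (simp add: m_def u_def)
  have nonneg: "m (int (Suc n)) = norm (1 / ((\<Prod>j\<in>{1..int (Suc n)}. w j) * a (int (Suc n)))) powr p" for n
    by (simp add: m_def u_def)
  have "m summable_on UNIV \<longleftrightarrow> summable (\<lambda>n. m (int n)) \<and> summable (\<lambda>n. m (- int (Suc n)))"
    by (rule summable_on_int_iff) (use m_pos less_imp_le in blast)
  also have "summable (\<lambda>n. m (int n)) \<longleftrightarrow> summable (\<lambda>n. m (int (Suc n)))"
    by (rule summable_Suc_iff[symmetric])
  finally show ?thesis unfolding neg nonneg by blast
qed

text \<open>The recursion for \<open>u\<close> makes the ratio of neighbouring values of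
  \<open>m\<close> the p-th power of a weight of \<open>T\<close>, which is bounded. Taking
  \<open>C\<close> at least one makes its powers increase with \<open>i\<close>.\<close>

lemma m_le_shift: "\<exists>C\<ge>1. \<forall>n i. m n \<le> C ^ i * m (n + int i)"
proof -
  obtain D where D: "0 \<le> D" "\<And>n. norm (w (n + 1) * a (n + 1) / a n) \<le> D"
    using ex_T_bound by blast
  define C where "C = max 1 (D powr p)"
  have step: "m n \<le> C * m (n + 1)" for n
  proof -
    have "u n / a n = (w (n + 1) * a (n + 1) / a n) * (u (n + 1) / a (n + 1))"
      using u_rec[of n] a_nz[of "n + 1"] by simp
    then have "m n = norm (w (n + 1) * a (n + 1) / a n) powr p * m (n + 1)"
      by (simp only: m_def norm_mult[of "w (n + 1) * a (n + 1) / a n"] powr_mult norm_ge_zero)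
    also have "\<dots> \<le> C * m (n + 1)"
    proof (rule mult_right_mono)
      have "norm (w (n + 1) * a (n + 1) / a n) powr p \<le> D powr p"
        using D p by (intro powr_mono2) auto
      then show "norm (w (n + 1) * a (n + 1) / a n) powr p \<le> C" by (simp add: C_def)
    qed (use m_pos less_imp_le in blast)
    finally show ?thesis .
  qed
  have C: "1 \<le> C" by (simp add: C_def)
  have "m n \<le> C ^ i * m (n + int i)" for n i
  proof (induction i)
    case (Suc i)
    have "C ^ i * m (n + int i) \<le> C ^ i * (C * m (n + int i + 1))"
      using step[of "n + int i"] C by (intro mult_left_mono) auto
    with Suc show ?case by (simp add: algebra_simps)
  qed simp
  then show ?thesis using C by (intro exI[of _ C]) simp
qed

section \<open>The implications between (i), (ii) and (iii)\<close>

text \<open>Among any \<open>k\<close> consecutive indices there is one where the periodic sequence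
  \<open>s\<close> takes its nonzero value \<open>s j\<close>. There \<open>m\<close> is a multiple
  of the summable \<open>g\<close>, and \<open>m_le_shift\<close> carries the bound back to the
  start of the window.\<close>

lemma periodic_imp_m_summable:
  assumes per: "periodic_vec (Xsp p a b) (Bw w \<Omega>) v" and "v \<noteq> 0"
  shows "m summable_on UNIV"
proof -
  obtain k :: nat where k: "1 \<le> k" "(Bw w \<Omega> ^^ k) v = v" and vX: "v \<in> Xsp p a b"
    using per by (auto simp: periodic_vec_def)
  obtain y where y: "v = laurent y" "lp p y" using vX by (auto simp: Xsp_eq)
  obtain s where s: "y = scale s" using ex_scale by blast
  have "(T ^^ k) y = y"
    using laurent_inj Bw_funpow_laurent[OF y(2), of k] y k(2) by metis
  then have s_per: "s (n + int k) = s n" for n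
    using scale_inj[of "\<lambda>n. s (n + int k)" s] unfolding s T_funpow_scale by (metis (no_types))
  have s_per_nat: "s (n + int k * int l) = s n" for n l
  proof (induction l)
    case (Suc l)
    then show ?case using s_per[of "n + int k * int l"] by (simp add: algebra_simps)
  qed simp
  have "\<exists>j. s j \<noteq> 0"
  proof (rule ccontr)
    assume "\<not> ?thesis"
    then have "v = 0" by (auto simp: y s laurent_def scale_def fun_eq_iff)
    then show False using \<open>v \<noteq> 0\<close> by simp
  qed
  then obtain j where j: "s j \<noteq> 0" ..
  have hit: "\<exists>i<k. s (n + int i) = s j" for n
  proof -
    define i where "i = nat ((j - n) mod int k)"
    have i: "i < k" "int i = (j - n) mod int k"
      using k(1) by (auto simp: i_def nat_less_iff)
    define l where "l = (j - n) div int k"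
    have jn: "j = n + int i + int k * l"
      using div_mult_mod_eq[of "j - n" "int k"] i(2) by (simp add: l_def algebra_simps)
    have "s (n + int i) = s j"
    \<comment> \<open>\<open>s_per_nat\<close> only moves forwards, so the sign of \<open>l\<close>
      decides from which of the two indices to start.\<close>
    proof (cases "0 \<le> l")
      case True
      then show ?thesis using s_per_nat[of "n + int i" "nat l"] jn by simp
    next
      case False
      then show ?thesis using s_per_nat[of j "nat (- l)"] jn by simp
    qed
    then show ?thesis using i(1) by blast
  qed
  obtain C where C: "1 \<le> C" "\<And>n i. m n \<le> C ^ i * m (n + int i)"
    using m_le_shift by blast
  define g where "g n = norm (s n) powr p * m n" for n
  have g0: "0 \<le> g n" for n using m_pos[of n] by (simp add: g_def)
  have g_sum: "g summable_on UNIV"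
    using y(2) unfolding lp_def s norm_scale_powr g_def .
  have g_shift: "(\<lambda>n. g (n + i)) summable_on UNIV" for i
    using g_sum summable_on_reindex_bij_betw[of "\<lambda>n. n + i" UNIV UNIV g]
    by (simp add: bij_plus_right)
  define B where "B = C ^ k / norm (s j) powr p"
  have B0: "0 \<le> B" using C by (simp add: B_def)
  show ?thesis
  proof (rule summable_on_comparison_test)
    have "(\<lambda>n. \<Sum>i<k. g (n + int i)) summable_on UNIV"
      using has_sum_finite_sum[where A = "{..<k}" and f = "\<lambda>i n. g (n + int i)" and U = UNIV
          and s = "\<lambda>i. \<Sum>\<^sub>\<infinity>n. g (n + int i)"] g_shift
      by (auto intro: has_sum_imp_summable)
    then show "(\<lambda>n. B * (\<Sum>i<k. g (n + int i))) summable_on UNIV"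
      by (rule summable_on_cmult_right)
    fix n
    obtain i where i: "i < k" "s (n + int i) = s j" using hit by blast
    have "m n \<le> C ^ i * m (n + int i)" by (rule C)
    also have "\<dots> \<le> C ^ k * m (n + int i)"
      using C(1) i(1) m_pos[of "n + int i"] by (intro mult_right_mono power_increasing) auto
    also have "\<dots> = B * g (n + int i)" using j i(2) by (simp add: B_def g_def)
    also have "\<dots> \<le> B * (\<Sum>i<k. g (n + int i))"
      using B0 g0 i(1) by (intro mult_left_mono member_le_sum) auto
    finally show "m n \<le> B * (\<Sum>i<k. g (n + int i))" .
  qed (use m_pos less_imp_le in blast)
qed

text \<open>Density puts a periodic vector within distance less than one of a vector at distance one
  from 0.\<close>

lemma chaotic_imp_periodic:
  assumes "chaotic_on (Xsp p a b) (Xnorm p a b) (Bw w \<Omega>)"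
  shows "\<exists>v. periodic_vec (Xsp p a b) (Bw w \<Omega>) v \<and> v \<noteq> 0"
proof -
  define \<delta> :: "int \<Rightarrow> complex" where "\<delta> n = (if n = 0 then 1 else 0)" for n
  have hs: "((\<lambda>n. norm (\<delta> n) powr p) has_sum 1) UNIV"
    by (rule has_sum_finite_neutralI[of "{0}"]) (auto simp: \<delta>_def)
  have \<delta>: "lp p \<delta>" using hs has_sum_imp_summable unfolding lp_def by blast
  then have J\<delta>: "lp p (J \<delta>)" by (rule lp_J)
  have N\<delta>: "Xnorm p a b (laurent (J \<delta>)) = 1"
    using infsumI[OF hs] by (simp add: Xnorm_def coef_laurent_J[OF \<delta>] lp_norm_def)
  \<comment> \<open>With the minus sign, \<open>0 - f\<close> is exactly the basis function of index
    0, whose norm has been computed.\<close>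
  define f where "f = laurent (\<lambda>n. - J \<delta> n)"
  have neg: "lp p (\<lambda>n. - J \<delta> n)" using J\<delta> by (simp add: lp_def)
  have "f \<in> Xsp p a b" using neg by (auto simp: Xsp_eq f_def)
  then obtain v where v: "periodic_vec (Xsp p a b) (Bw w \<Omega>) v" "Xnorm p a b (v - f) < 1"
    using assms unfolding chaotic_on_def by (meson zero_less_one)
  have "v \<noteq> 0"
  proof
    assume "v = 0"
    also have "0 = laurent (\<lambda>_. 0)" by (auto simp: laurent_def)
    finally have "v - f = laurent (J \<delta>)"
      using laurent_diff[OF _ neg, of "\<lambda>_. 0"] by (simp add: f_def lp_def)
    then show False using v(2) N\<delta> by simp
  qed
  with v(1) show ?thesis by blast
qed

text \<open>Through \<open>laurent\<close> and \<open>scale\<close> the operator becomes the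
  unweighted shift on \<open>W.wlp\<close>, so both density results for that shift carry
  over.\<close>

lemma m_summable_imp_chaotic:
  assumes "m summable_on UNIV"
  shows "chaotic_on (Xsp p a b) (Xnorm p a b) (Bw w \<Omega>)"
proof -
  interpret W: summable_weight p m
    by unfold_locales (use p m_pos assms in auto)
  have wlp_iff: "W.wlp s \<longleftrightarrow> lp p (scale s)" for s
    unfolding W.wlp_def lp_def norm_scale_powr ..
  have modular_eq: "W.modular s = (\<Sum>\<^sub>\<infinity>n. norm (scale s n) powr p)" for s
    unfolding W.modular_def norm_scale_powr ..
  obtain K where K: "0 < K" "\<And>y. lp p y \<Longrightarrow>
      Xnorm p a b (laurent y) \<le> (K * (\<Sum>\<^sub>\<infinity>n. norm (y n) powr p)) powr (1 / p)"
    using Xnorm_laurent_le by blast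
  \<comment> \<open>The threshold \<open>e powr p / K\<close> undoes the constant and the root in
    the bound on \<open>Xnorm\<close>.\<close>
  have close: "Xnorm p a b (laurent (scale s) - laurent (scale t)) < e"
    if "W.wlp s" "W.wlp t" "0 < e" "W.modular (\<lambda>n. s n - t n) < e powr p / K" for s t e
  proof -
    have d: "W.wlp (\<lambda>n. s n - t n)" by (rule W.wlp_diff) fact+
    have "(\<lambda>n. scale s n - scale t n) = scale (\<lambda>n. s n - t n)"
      by (rule ext) (simp only: scale_def right_diff_distrib)
    then have "Xnorm p a b (laurent (scale s) - laurent (scale t))
        = Xnorm p a b (laurent (scale (\<lambda>n. s n - t n)))"
      using laurent_diff[of "scale s" "scale t"] that by (simp add: wlp_iff)
    also have "\<dots> \<le> (K * W.modular (\<lambda>n. s n - t n)) powr (1 / p)"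
      using K(2)[of "scale (\<lambda>n. s n - t n)"] d by (simp add: wlp_iff modular_eq)
    also have "\<dots> < (e powr p) powr (1 / p)"
    proof (rule powr_less_mono2)
      have "0 \<le> W.modular (\<lambda>n. s n - t n)"
        unfolding modular_eq by (intro infsum_nonneg) auto
      then show "0 \<le> K * W.modular (\<lambda>n. s n - t n)" using K(1) by simp
      show "K * W.modular (\<lambda>n. s n - t n) < e powr p"
        using that(4) K(1) by (simp add: field_simps)
    qed (use p in auto)
    also have "\<dots> = e" using that(3) p by (simp add: powr_powr)
    finally show ?thesis .
  qed
  have X_cases: "\<exists>t. W.wlp t \<and> f = laurent (scale t)" if "f \<in> Xsp p a b" for f
  proof -
    obtain y where y: "f = laurent y" "lp p y" using \<open>f \<in> Xsp p a b\<close> by (auto simp: Xsp_eq)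
    moreover obtain t where "y = scale t" using ex_scale by blast
    ultimately show ?thesis by (auto simp: wlp_iff)
  qed
  have X_intro: "laurent (scale t) \<in> Xsp p a b" if "W.wlp t" for t
    using that by (auto simp: Xsp_eq wlp_iff)
  have orbit: "(Bw w \<Omega> ^^ k) (laurent (scale s)) = laurent (scale (\<lambda>n. s (n + int k)))"
    and wlp_shift: "W.wlp (\<lambda>n. s (n + int k))" if "W.wlp s" for s k
    using Bw_funpow_laurent[of "scale s" k] that by (simp_all add: wlp_iff T_funpow_scale)
  have "hypercyclic_on (Xsp p a b) (Xnorm p a b) (Bw w \<Omega>)"
  proof -
    obtain x where x: "W.wlp x"
      "\<And>t e. W.wlp t \<Longrightarrow> 0 < e \<Longrightarrow> \<exists>k::nat. W.modular (\<lambda>n. x (n + int k) - t n) < e"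
      using W.ex_dense_shift_orbit by blast
    show ?thesis
      unfolding hypercyclic_on_def
    proof (intro bexI[of _ "laurent (scale x)"] ballI allI impI)
      fix f and e :: real assume f: "f \<in> Xsp p a b" and e: "0 < e"
      obtain t where t: "W.wlp t" "f = laurent (scale t)" using X_cases[OF f] by blast
      obtain k :: nat where "W.modular (\<lambda>n. x (n + int k) - t n) < e powr p / K"
        using x(2)[OF t(1), of "e powr p / K"] e K(1) by auto
      then have "Xnorm p a b (laurent (scale (\<lambda>n. x (n + int k))) - f) < e"
        unfolding t(2) using e by (intro close wlp_shift x(1) t(1))
      then show "\<exists>k. (Bw w \<Omega> ^^ k) (laurent (scale x)) \<in> Xsp p a b \<and>
          Xnorm p a b ((Bw w \<Omega> ^^ k) (laurent (scale x)) - f) < e"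
        using orbit[OF x(1)] X_intro[OF wlp_shift[OF x(1)]] by (intro exI[of _ k]) simp
    qed (rule X_intro[OF x(1)])
  qed
  moreover have "\<exists>v. periodic_vec (Xsp p a b) (Bw w \<Omega>) v \<and> Xnorm p a b (v - f) < e"
    if f: "f \<in> Xsp p a b" and e: "0 < e" for f e
  proof -
    obtain t where t: "W.wlp t" "f = laurent (scale t)" using X_cases[OF f] by blast
    have "0 < e powr p / K" using e K(1) by simp
    from W.periodic_dense[OF t(1) this]
    obtain s and k :: nat where s: "1 \<le> k" "\<And>n. s (n + int k) = s n" "W.wlp s"
      "W.modular (\<lambda>n. s n - t n) < e powr p / K"
      by blast
    have "periodic_vec (Xsp p a b) (Bw w \<Omega>) (laurent (scale s))"
      unfolding periodic_vec_def using X_intro[OF s(3)] orbit[OF s(3), of k] s(1,2) by auto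
    moreover have "Xnorm p a b (laurent (scale s) - f) < e"
      unfolding t(2) using e s t by (intro close) auto
    ultimately show ?thesis by blast
  qed
  ultimately show ?thesis unfolding chaotic_on_def by blast
qed

end

theorem theorem4p7:
  fixes p q :: real and a b w :: "int \<Rightarrow> complex"
  assumes p: "1 < p" and q: "1 / p + 1 / q = 1"
    and a_nz: "\<forall>n. a n \<noteq> 0" and b_neg: "\<forall>n<0. b n = 0"
    and invR_fin: "invR_ann a b \<noteq> \<infinity>" and rR: "r_ann a < R_ann a b"
    and w_nz: "\<forall>n. w n \<noteq> 0"
    and w_bdd: "bdd_above (range (\<lambda>n. norm (w (n + 1) * a (n + 1) / a n)))"
    and b_lim: "limsup (\<lambda>n::nat. ereal (norm (b (int n) / a (int n + 1)))) < 1"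
  shows "(chaotic_on (Xsp p a b) (Xnorm p a b) (Bw w (Omega a b))
            \<longrightarrow> (\<exists>v. periodic_vec (Xsp p a b) (Bw w (Omega a b)) v \<and> v \<noteq> 0))
       \<and> ((\<exists>v. periodic_vec (Xsp p a b) (Bw w (Omega a b)) v \<and> v \<noteq> 0)
            \<longrightarrow> summable (\<lambda>n::nat. norm ((\<Prod>j\<in>{1 - int (Suc n)..0}. w j) / a (- int (Suc n))) powr p)
              \<and> summable (\<lambda>n::nat. norm (1 / ((\<Prod>j\<in>{1..int (Suc n)}. w j) * a (int (Suc n)))) powr p))
       \<and> ((\<forall>m::nat. summable (\<lambda>i::nat. norm (\<Prod>k\<in>{1..Suc i}. b (int (Suc m) + int k - 1) / a (int (Suc m) + int k)) powr p))
           \<and> summable (\<lambda>m::nat. (\<Sum>i. norm (\<Prod>k\<in>{1..Suc i}. b (int (Suc m) + int k - 1) / a (int (Suc m) + int k)) powr p) powr (q / p))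
          \<longrightarrow> (summable (\<lambda>n::nat. norm ((\<Prod>j\<in>{1 - int (Suc n)..0}. w j) / a (- int (Suc n))) powr p)
              \<and> summable (\<lambda>n::nat. norm (1 / ((\<Prod>j\<in>{1..int (Suc n)}. w j) * a (int (Suc n)))) powr p)
              \<longrightarrow> chaotic_on (Xsp p a b) (Xnorm p a b) (Bw w (Omega a b))))"
proof -
  interpret annular_shift p a b w
    by unfold_locales (use assms in auto)
  show ?thesis
    unfolding m_summable_iff[symmetric]
    using chaotic_imp_periodic periodic_imp_m_summable m_summable_imp_chaotic by blast
qed

end
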